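(* Let $q\in(-1,1)$, let $\mathcal{H}$ be a real separable Hilbert space, let $\mathcal{H}_+$ be a real Hilbert space which is densely embedded into $\mathcal{H}$ and satisfies $\|\cdot\|_{\mathcal{H}}\le\|\cdot\|_{\mathcal{H}_+}$, and let $\mathcal{H}_-$ be the dual space of $\mathcal{H}_+$ with respect to the center space $\mathcal{H}$. Let $\phi(z)=\sum_{n=0}^\infty a_nz^n$ be an analytic function of a complex variable $z$ defined in a neighborhood of zero, and assume that the series $\sum_{n=0}^\infty a_nz^n$ converges absolutely in the open disk of radius $R>0$ (centered at zero). Then, for each $F=(f^{(n)})_{n=0}^\infty\in\mathbb{F}_q(\mathcal{H}_-,-2)$ such that $|f^{(0)}|<R$, we have $$\phi^{\otimes}(F):=\sum_{n=0}^\infty a_nF^{\otimes n}\in\mathbb{F}_q(\mathcal{H}_-,-2)_{\mathbb{C}}.$$ More precisely, there exists $r\ge1$ such that the series $\sum_{n=0}^\infty a_nF^{\otimes n}$ converges in $\mathbb{F}_q(\mathcal{H}_-,r^{-1},-2)_{\mathbb{C}}$.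
   Context: Notation. $[n]_{|q|}:=1+|q|+\dots+|q|^{n-1}$, $[n]_{|q|}!:=[1]_{|q|}\cdots[n]_{|q|}$, $[0]_{|q|}!:=1$; convention $0^0:=1$. For a real Hilbert space $\mathcal{K}$ and $c>0$, $\mathcal{K}c$ denotes the Hilbert space equal to $\mathcal{K}$ as a set with scalar product $c(\cdot,\cdot)_{\mathcal{K}}$. $\mathcal{K}^{\otimes n}$ is the Hilbert space tensor power. A subscript $\mathbb{C}$ on a real space denotes its complexification. The dual space $\mathcal{H}_-$ of $\mathcal{H}_+$ with respect to the center space $\mathcal{H}$ is the Hilbert space with $\mathcal{H}_+\subset\mathcal{H}\subset\mathcal{H}_-$ (dense continuous embeddings) realizing the dual of $\mathcal{H}_+$, where the dual pairing between $\mathcal{H}_-$ and $\mathcal{H}_+$ is given by an extension of the scalar product in $\mathcal{H}$. For a real separable Hilbert space $\mathcal{K}$ and $n\in\mathbb{N}$ let $P_q^{(n)}$ be the bounded (strictly positive) linear operator on $\mathcal{K}^{\otimes n}$ given by $P_q^{(n)}f_1\otimes\dots\otimes f_n:=\sum_{\pi\in S_n}q^{\operatorname{inv}(\pi)}f_{\pi(1)}\otimes\dots\otimes f_{\pi(n)}$, where $\operatorname{inv}(\pi)$ is the number of pairs $i<j$ with $\pi(i)>\pi(j)$. $\mathbb{F}_q^{(n)}(\mathcal{K})$ is the Hilbert space equal to $\mathcal{K}^{\otimes n}$ as a set with scalar product $(f,g)_{\mathbb{F}_q^{(n)}(\mathcal{K})}:=(P_q^{(n)}f,P_q^{(n)}g)_{\mathcal{K}^{\otimes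 n}}$; $\mathbb{F}_q^{(0)}(\mathcal{K}):=\mathbb{R}$. For $r>0$ and $\alpha\in\mathbb{R}$, $\mathbb{F}_q(\mathcal{K},r,\alpha):=\bigoplus_{n=0}^\infty\mathbb{F}_q^{(n)}(\mathcal{K})\,r^n([n]_{|q|}!)^\alpha$ (Hilbert space direct sum), and $\mathbb{F}_q(\mathcal{H}_-,-2):=\operatorname{ind\,lim}_{r\ge1}\mathbb{F}_q(\mathcal{H}_-,r^{-1},-2)$, the union of these Hilbert spaces over $r\ge1$ with the inductive limit topology. Tensor multiplication: for $F=(f^{(n)})_{n\ge0}$ and $G=(g^{(n)})_{n\ge0}$, $F\otimes G:=\big(\sum_{i=0}^nf^{(i)}\otimes g^{(n-i)}\big)_{n\ge0}$. $F^{\otimes n}$ is the $n$-fold product of $F$ with itself, with $F^{\otimes0}:=\Omega=(1,0,0,\dots)$. *)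

theory Defs
  imports "HOL-Analysis.Analysis" "HOL-Combinatorics.Combinatorics"
begin

section \<open>The dual of a Hilbert space with respect to a center space\<close>

definition dense_embedding :: "('a::real_normed_vector \<Rightarrow> 'b::real_normed_vector) \<Rightarrow> bool"
  where "dense_embedding J \<longleftrightarrow> bounded_linear J \<and> inj J \<and> closure (range J) = UNIV"

text \<open>
  The embeddings \<open>J : H\<^sub>+ \<rightarrow> H\<close> and \<open>I : H \<rightarrow> H\<^sub>-\<close> play the role of the inclusions
  \<open>H\<^sub>+ \<subseteq> H \<subseteq> H\<^sub>-\<close>; \<open>D w x\<close> is the dual pairing of \<open>w \<in> H\<^sub>-\<close> with \<open>x \<in> H\<^sub>+\<close>.
  The map \<open>D\<close> identifies \<open>H\<^sub>-\<close> isometrically with the full dual of \<open>H\<^sub>+\<close>.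
\<close>

definition dual_wrt_center ::
  "('p::real_inner \<Rightarrow> 'h::real_inner) \<Rightarrow> ('h \<Rightarrow> 'm::real_inner) \<Rightarrow> ('m \<Rightarrow> 'p \<Rightarrow>\<^sub>L real) \<Rightarrow> bool"
  where "dual_wrt_center J I D \<longleftrightarrow>
    dense_embedding J \<and> dense_embedding I \<and>
    linear D \<and> surj D \<and> (\<forall>w. norm (D w) = norm w) \<and>
    (\<forall>h x. blinfun_apply (D (I h)) x = h \<bullet> J x)"


section \<open>Hilbert space tensor powers\<close>

definition orthonormal_basis :: "'k::real_inner set \<Rightarrow> bool"
  where "orthonormal_basis B \<longleftrightarrow>
    pairwise orthogonal B \<and> (\<forall>b\<in>B. norm b = 1) \<and> closure (span B) = UNIV"

text \<open>
  The tensor power \<open>K\<^sup>\<otimes>\<^sup>n\<close> of a real Hilbert space \<open>K\<close> is realised as the Hilbert space of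
  Hilbert-Schmidt functionals on \<open>K\<^sup>n\<close>: a tensor \<open>f\<close> is represented by the bounded
  \<open>n\<close>-linear functional sending \<open>(x\<^sub>1,\<dots>,x\<^sub>n)\<close> to the scalar product of \<open>f\<close> with
  \<open>x\<^sub>1 \<otimes> \<dots> \<otimes> x\<^sub>n\<close>. Tuples are lists, and the functional is extended by \<open>0\<close> to lists of
  length other than \<open>n\<close>. The Hilbert-Schmidt scalar product is independent of the
  orthonormal basis used to write it down, so a fixed one is chosen
  (existence is \<open>orthonormal_basis_exists\<close> at the end). It satisfies the defining
  identity of the tensor power on elementary tensors, \<open>tensor_inner_elementary_tensor\<close>.
\<close>

type_synonym 'k tensor = "'k list \<Rightarrow> real"

definition onb :: "'k::real_inner set"
  where "onb = (SOME B. orthonormal_basis B)"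

definition onb_tuples :: "nat \<Rightarrow> 'k::real_inner list set"
  where "onb_tuples n = {xs. length xs = n \<and> set xs \<subseteq> onb}"

definition multilinear_functional :: "nat \<Rightarrow> ('k::real_inner) tensor \<Rightarrow> bool"
  where "multilinear_functional n f \<longleftrightarrow>
    (\<forall>xs. length xs \<noteq> n \<longrightarrow> f xs = 0) \<and>
    (\<forall>xs i. length xs = n \<longrightarrow> i < n \<longrightarrow> linear (\<lambda>x. f (xs[i := x]))) \<and>
    (\<exists>C. \<forall>xs. length xs = n \<longrightarrow> \<bar>f xs\<bar> \<le> C * (\<Prod>i<n. norm (xs ! i)))"

definition tensor_power :: "nat \<Rightarrow> ('k::real_inner) tensor set"
  where "tensor_power n =
    {f. multilinear_functional n f \<and> (\<lambda>xs. (f xs)\<^sup>2) summable_on onb_tuples n}"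

definition tensor_inner :: "nat \<Rightarrow> ('k::real_inner) tensor \<Rightarrow> 'k tensor \<Rightarrow> real"
  where "tensor_inner n f g = (\<Sum>\<^sub>\<infinity>xs\<in>onb_tuples n. f xs * g xs)"

text \<open>The elementary tensor \<open>f\<^sub>1 \<otimes> \<dots> \<otimes> f\<^sub>n\<close>.\<close>

definition elementary_tensor :: "'k::real_inner list \<Rightarrow> 'k tensor"
  where "elementary_tensor fs =
    (\<lambda>xs. if length xs = length fs then \<Prod>i<length fs. (fs ! i) \<bullet> (xs ! i) else 0)"

definition tensor_mult :: "nat \<Rightarrow> nat \<Rightarrow> 'k tensor \<Rightarrow> 'k tensor \<Rightarrow> 'k tensor"
  where "tensor_mult m n f g =
    (\<lambda>xs. if length xs = m + n then f (take m xs) * g (drop m xs) else 0)"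


section \<open>The operator \<open>P\<^sub>q\<close> and the \<open>q\<close>-Fock spaces\<close>

definition num_inversions :: "nat \<Rightarrow> (nat \<Rightarrow> nat) \<Rightarrow> nat"
  where "num_inversions n \<pi> = card {(i, j). i < j \<and> j < n \<and> \<pi> i > \<pi> j}"

text \<open>
  In terms of functionals, replacing \<open>f\<^sub>1 \<otimes> \<dots> \<otimes> f\<^sub>n\<close> by
  \<open>f\<^bsub>\<pi>(1)\<^esub> \<otimes> \<dots> \<otimes> f\<^bsub>\<pi>(n)\<^esub>\<close> amounts to permuting the arguments by the inverse of \<open>\<pi>\<close>;
  see \<open>Pq_elementary_tensor\<close> at the end.
\<close>

definition Pq :: "real \<Rightarrow> nat \<Rightarrow> 'k tensor \<Rightarrow> 'k tensor"
  where "Pq q n f =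
    (\<lambda>xs. if length xs = n
       then \<Sum>\<pi> | \<pi> permutes {..<n}. q ^ num_inversions n \<pi> * f (permute_list (inv \<pi>) xs)
       else 0)"

definition q_inner :: "real \<Rightarrow> nat \<Rightarrow> ('k::real_inner) tensor \<Rightarrow> 'k tensor \<Rightarrow> real"
  where "q_inner q n f g = tensor_inner n (Pq q n f) (Pq q n g)"

definition q_number :: "real \<Rightarrow> nat \<Rightarrow> real"
  where "q_number q n = (\<Sum>k<n. \<bar>q\<bar> ^ k)"

definition q_factorial :: "real \<Rightarrow> nat \<Rightarrow> real"
  where "q_factorial q n = (\<Prod>k=1..n. q_number q k)"

definition fock_weight :: "real \<Rightarrow> real \<Rightarrow> real \<Rightarrow> nat \<Rightarrow> real"
  where "fock_weight q r \<alpha> n = r ^ n * q_factorial q n powr \<alpha>"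

text \<open>The Hilbert space \<open>F\<^sub>q(K, r, \<alpha>)\<close>: its elements and its scalar product.\<close>

definition fock :: "real \<Rightarrow> real \<Rightarrow> real \<Rightarrow> (nat \<Rightarrow> ('k::real_inner) tensor) set"
  where "fock q r \<alpha> =
    {F. (\<forall>n. F n \<in> tensor_power n) \<and>
        summable (\<lambda>n. fock_weight q r \<alpha> n * q_inner q n (F n) (F n))}"

definition fock_inner ::
  "real \<Rightarrow> real \<Rightarrow> real \<Rightarrow> (nat \<Rightarrow> ('k::real_inner) tensor) \<Rightarrow> (nat \<Rightarrow> 'k tensor) \<Rightarrow> real"
  where "fock_inner q r \<alpha> F G = (\<Sum>n. fock_weight q r \<alpha> n * q_inner q n (F n) (G n))"

text \<open>The underlying set of the inductive limit of \<open>F\<^sub>q(K, r\<^sup>-\<^sup>1, \<alpha>)\<close> over \<open>r \<ge> 1\<close>.\<close>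

definition fock_ind_lim :: "real \<Rightarrow> real \<Rightarrow> (nat \<Rightarrow> ('k::real_inner) tensor) set"
  where "fock_ind_lim q \<alpha> = (\<Union>r\<in>{1..}. fock q (inverse r) \<alpha>)"


section \<open>Complexification\<close>

text \<open>
  An element \<open>F + i G\<close> of the complexification is represented by the sequence of complex-valued
  functionals with real part \<open>F\<close> and imaginary part \<open>G\<close>.
\<close>

type_synonym 'k ctensor = "'k list \<Rightarrow> complex"

definition Re_seq :: "(nat \<Rightarrow> 'k ctensor) \<Rightarrow> nat \<Rightarrow> 'k tensor"
  where "Re_seq Z = (\<lambda>n xs. Re (Z n xs))"

definition Im_seq :: "(nat \<Rightarrow> 'k ctensor) \<Rightarrow> nat \<Rightarrow> 'k tensor"
  where "Im_seq Z = (\<lambda>n xs. Im (Z n xs))"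

definition complexification :: "(nat \<Rightarrow> 'k tensor) set \<Rightarrow> (nat \<Rightarrow> 'k ctensor) set"
  where "complexification S = {Z. Re_seq Z \<in> S \<and> Im_seq Z \<in> S}"

definition cfock_norm :: "real \<Rightarrow> real \<Rightarrow> real \<Rightarrow> (nat \<Rightarrow> ('k::real_inner) ctensor) \<Rightarrow> real"
  where "cfock_norm q r \<alpha> Z =
    sqrt (fock_inner q r \<alpha> (Re_seq Z) (Re_seq Z) + fock_inner q r \<alpha> (Im_seq Z) (Im_seq Z))"

definition converges_in_cfock ::
  "real \<Rightarrow> real \<Rightarrow> real \<Rightarrow> (nat \<Rightarrow> nat \<Rightarrow> ('k::real_inner) ctensor) \<Rightarrow> (nat \<Rightarrow> 'k ctensor) \<Rightarrow> bool"
  where "converges_in_cfock q r \<alpha> S Z \<longleftrightarrow>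
    (\<forall>N. S N \<in> complexification (fock q r \<alpha>)) \<and> Z \<in> complexification (fock q r \<alpha>) \<and>
    (\<lambda>N. cfock_norm q r \<alpha> (\<lambda>n xs. S N n xs - Z n xs)) \<longlonglongrightarrow> 0"


section \<open>Tensor multiplication and tensor power series\<close>

definition fock_mult :: "(nat \<Rightarrow> 'k tensor) \<Rightarrow> (nat \<Rightarrow> 'k tensor) \<Rightarrow> nat \<Rightarrow> 'k tensor"
  where "fock_mult F G = (\<lambda>n xs. \<Sum>i\<le>n. tensor_mult i (n - i) (F i) (G (n - i)) xs)"

definition vacuum :: "nat \<Rightarrow> 'k tensor"
  where "vacuum = (\<lambda>n xs. if n = 0 \<and> xs = [] then 1 else 0)"

primrec fock_power :: "(nat \<Rightarrow> 'k tensor) \<Rightarrow> nat \<Rightarrow> nat \<Rightarrow> 'k tensor"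
  where
    "fock_power F 0 = vacuum"
  | "fock_power F (Suc n) = fock_mult F (fock_power F n)"

definition tensor_series_partial ::
  "(nat \<Rightarrow> complex) \<Rightarrow> (nat \<Rightarrow> 'k tensor) \<Rightarrow> nat \<Rightarrow> nat \<Rightarrow> 'k ctensor"
  where "tensor_series_partial a F N =
    (\<lambda>n xs. \<Sum>k<N. a k * complex_of_real (fock_power F k n xs))"


section \<open>Well-definedness and the action on elementary tensors\<close>

lemma Pq_elementary_tensor:
  "Pq q (length fs) (elementary_tensor fs) =
    (\<lambda>xs. \<Sum>\<pi> | \<pi> permutes {..<length fs}.
       q ^ num_inversions (length fs) \<pi> * elementary_tensor (permute_list \<pi> fs) xs)"
proof -
  have "(\<Prod>i<length fs. (fs ! i) \<bullet> (permute_list (inv \<pi>) xs ! i)) =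
        (\<Prod>i<length fs. (permute_list \<pi> fs ! i) \<bullet> (xs ! i))"
    if p: "\<pi> permutes {..<length fs}" and l: "length xs = length fs" for \<pi> xs
  proof -
    have "(\<Prod>i<length fs. (fs ! i) \<bullet> (permute_list (inv \<pi>) xs ! i)) =
          (\<Prod>i<length fs. (fs ! \<pi> i) \<bullet> (permute_list (inv \<pi>) xs ! \<pi> i))"
      by (rule prod.permute[OF p, unfolded comp_def])
    also have "\<dots> = (\<Prod>i<length fs. (permute_list \<pi> fs ! i) \<bullet> (xs ! i))"
      using p permutes_inv[OF p] permutes_in_image[OF p] l
      by (intro prod.cong) (auto simp: permute_list_nth permutes_inverses)
    finally show ?thesis .
  qed
  then show ?thesis
    by (auto simp: Pq_def elementary_tensor_def fun_eq_iff intro!: sum.cong)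
qed

lemma tensor_mult_elementary_tensor:
  "tensor_mult (length fs) (length gs) (elementary_tensor fs) (elementary_tensor gs) =
    elementary_tensor (fs @ gs)"
proof -
  have "(\<Prod>i<m + n. h i) = (\<Prod>i<m. h i) * (\<Prod>i<n. h (m + i))" for h :: "nat \<Rightarrow> real" and m n
    by (induction n) (auto simp: mult_ac)
  then show ?thesis
    by (auto simp: tensor_mult_def elementary_tensor_def fun_eq_iff nth_append)
qed

lemma closest_point_subspace:
  fixes M :: "'k::{real_inner, complete_space} set"
  assumes "subspace M" "closed M"
  shows "\<exists>y\<in>M. \<forall>z\<in>M. (x - y) \<bullet> z = 0"
proof -
  have ne: "M \<noteq> {}" using assms(1) subspace_0 by blast
  define d where "d = infdist x M"
  have d0: "d \<ge> 0" by (simp add: d_def infdist_nonneg)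
  have lb: "d \<le> norm (x - y)" if "y \<in> M" for y
    using infdist_le[OF that, of x] by (simp add: d_def dist_norm)
  have "\<exists>y\<in>M. norm (x - y) < d + inverse (Suc n)" for n
  proof (rule ccontr)
    assume "\<not> ?thesis"
    then have "d + inverse (Suc n) \<le> infdist x M"
      unfolding infdist_notempty[OF ne]
      by (intro cINF_greatest[OF ne]) (auto simp: dist_norm not_less)
    then show False
      by (simp add: d_def)
  qed
  then obtain y where y: "\<And>n. y n \<in> M" "\<And>n. norm (x - y n) < d + inverse (Suc n)"
    by metis
  have par: "(norm (y m - y n))\<^sup>2 \<le> 2 * (norm (x - y m))\<^sup>2 + 2 * (norm (x - y n))\<^sup>2 - 4 * d\<^sup>2" for m n
  proof -
    have "(1/2) *\<^sub>R (y m + y n) \<in> M"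
      using assms(1) y(1) by (simp add: subspace_add subspace_scale)
    then have "d \<le> norm (x - (1/2) *\<^sub>R (y m + y n))" by (rule lb)
    then have "d\<^sup>2 \<le> (norm (x - (1/2) *\<^sub>R (y m + y n)))\<^sup>2"
      using d0 by (intro power_mono)
    moreover have "(norm (y m - y n))\<^sup>2 = 2 * (norm (x - y m))\<^sup>2 + 2 * (norm (x - y n))\<^sup>2 
        - 4 * (norm (x - (1/2) *\<^sub>R (y m + y n)))\<^sup>2"
      by (simp add: power2_norm_eq_inner inner_diff_left inner_diff_right inner_add_left
          inner_add_right inner_commute algebra_simps)
    ultimately show ?thesis by linarith
  qed
  have lim: "(\<lambda>n. norm (x - y n)) \<longlonglongrightarrow> d"
  proof (rule tendsto_sandwich)
    show "(\<lambda>n. d) \<longlonglongrightarrow> d" by simp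
    show "(\<lambda>n. d + inverse (real (Suc n))) \<longlonglongrightarrow> d"
      using tendsto_add[OF tendsto_const LIMSEQ_inverse_real_of_nat, of d] by simp
    show "\<forall>\<^sub>F n in sequentially. d \<le> norm (x - y n)" using lb y(1) by simp
    show "\<forall>\<^sub>F n in sequentially. norm (x - y n) \<le> d + inverse (real (Suc n))"
      using y(2) by (simp add: less_imp_le)
  qed
  have "Cauchy y"
  proof (rule metric_CauchyI)
    fix e :: real assume e: "e > 0"
    have "(\<lambda>n. (norm (x - y n))\<^sup>2) \<longlonglongrightarrow> d\<^sup>2" using lim by (intro tendsto_intros)
    then have "\<forall>\<^sub>F n in sequentially. (norm (x - y n))\<^sup>2 < d\<^sup>2 + e\<^sup>2 / 4"
      by (rule order_tendstoD) (use e in simp)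
    then obtain N where N: "\<And>n. n \<ge> N \<Longrightarrow> (norm (x - y n))\<^sup>2 < d\<^sup>2 + e\<^sup>2 / 4"
      by (auto simp: eventually_sequentially)
    have "dist (y m) (y n) < e" if "m \<ge> N" "n \<ge> N" for m n
    proof -
      have "(norm (y m - y n))\<^sup>2 < e\<^sup>2" using par[of m n] N[OF that(1)] N[OF that(2)] by linarith
      then show ?thesis using e by (simp add: dist_norm power_less_imp_less_base)
    qed
    then show "\<exists>M. \<forall>m\<ge>M. \<forall>n\<ge>M. dist (y m) (y n) < e" by blast
  qed
  then obtain z where z: "y \<longlonglongrightarrow> z" using Cauchy_convergent_iff convergent_def by blast
  have zM: "z \<in> M" using closed_sequentially[OF assms(2)] y(1) z by blast
  have zd: "norm (x - z) = d"
    by (rule LIMSEQ_unique[OF _ lim]) (intro tendsto_intros z)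
  have "(x - z) \<bullet> w = 0" if w: "w \<in> M" for w
  proof (cases "w = 0")
    case False
    define t where "t = ((x - z) \<bullet> w) / (w \<bullet> w)"
    have ww: "w \<bullet> w > 0" using False by simp
    have "z + t *\<^sub>R w \<in> M" using assms(1) zM w by (simp add: subspace_add subspace_scale)
    from lb[OF this] have "d\<^sup>2 \<le> (norm (x - (z + t *\<^sub>R w)))\<^sup>2"
      using d0 by (intro power_mono)
    also have "\<dots> = (norm (x - z))\<^sup>2 - 2 * t * ((x - z) \<bullet> w) + t * t * (w \<bullet> w)"
      by (simp add: power2_norm_eq_inner inner_diff_left inner_diff_right inner_add_left
          inner_add_right inner_commute algebra_simps)
    also have "\<dots> = d\<^sup>2 - ((x - z) \<bullet> w)\<^sup>2 / (w \<bullet> w)"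
      using ww by (simp add: zd t_def field_simps power2_eq_square)
    finally have "((x - z) \<bullet> w)\<^sup>2 / (w \<bullet> w) \<le> 0" by simp
    then show ?thesis using ww by (simp add: divide_le_0_iff)
  qed simp
  with zM show ?thesis by blast
qed

lemma subspace_closure:
  fixes S :: "'k::real_normed_vector set"
  assumes "subspace S"
  shows "subspace (closure S)"
proof (rule subspaceI)
  show "0 \<in> closure S" using assms closure_subset subspace_0 by blast
next
  fix x y assume "x \<in> closure S" "y \<in> closure S"
  then obtain f g where f: "\<And>n. f n \<in> S" "f \<longlonglongrightarrow> x" and g: "\<And>n. g n \<in> S" "g \<longlonglongrightarrow> y"
    unfolding closure_sequential by blast
  have "(\<lambda>n. f n + g n) \<longlonglongrightarrow> x + y" using f(2) g(2) by (rule tendsto_add)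
  moreover have "f n + g n \<in> S" for n using assms f(1) g(1) by (rule subspace_add)
  ultimately show "x + y \<in> closure S"
    unfolding closure_sequential by (intro exI[of _ "\<lambda>n. f n + g n"] conjI allI)
next
  fix c x assume "x \<in> closure S"
  then obtain f where f: "\<And>n. f n \<in> S" "f \<longlonglongrightarrow> x"
    unfolding closure_sequential by blast
  have "(\<lambda>n. c *\<^sub>R f n) \<longlonglongrightarrow> c *\<^sub>R x" using f(2) by (intro tendsto_intros)
  moreover have "c *\<^sub>R f n \<in> S" for n using assms f(1) by (rule subspace_scale)
  ultimately show "c *\<^sub>R x \<in> closure S"
    unfolding closure_sequential by (intro exI[of _ "\<lambda>n. c *\<^sub>R f n"] conjI allI)
qed

lemma orthonormal_basis_exists:
  "\<exists>B :: 'k::{real_inner, complete_space} set. orthonormal_basis B"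
proof -
  let ?A = "{B :: 'k set. pairwise orthogonal B \<and> (\<forall>b\<in>B. norm b = 1)}"
  have "\<exists>M\<in>?A. \<forall>X\<in>?A. M \<subseteq> X \<longrightarrow> X = M"
  proof (rule subset_Zorn_nonempty)
    show "?A \<noteq> {}" by (auto intro!: exI[of _ "{}"] simp: pairwise_def)
    fix C :: "'k set set" assume "C \<noteq> {}" and C: "subset.chain ?A C"
    have "pairwise orthogonal (\<Union>C)"
      unfolding pairwise_def
    proof (intro ballI impI)
      fix x y assume "x \<in> \<Union>C" "y \<in> \<Union>C" and xy: "x \<noteq> y"
      then obtain X Y where X: "x \<in> X" "X \<in> C" "y \<in> Y" "Y \<in> C" by auto
      then have "X \<subseteq> Y \<or> Y \<subseteq> X" using C by (auto simp: subset_chain_def)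
      moreover have "pairwise orthogonal X" "pairwise orthogonal Y"
        using C X by (auto simp: subset_chain_def)
      ultimately show "orthogonal x y" using X xy by (auto simp: pairwise_def)
    qed
    then show "\<Union>C \<in> ?A" using C by (auto simp: subset_chain_def)
  qed
  then obtain B where BA: "B \<in> ?A" and BX: "\<forall>X\<in>?A. B \<subseteq> X \<longrightarrow> X = B" by (rule bexE)
  have B: "pairwise orthogonal B" "\<And>b. b \<in> B \<Longrightarrow> norm b = 1" using BA by simp_all
  have mx: "X = B" if "pairwise orthogonal X" "\<forall>b\<in>X. norm b = 1" "B \<subseteq> X" for X
    using BX[rule_format, of X] that by simp
  have "x \<in> closure (span B)" for x
  proof -
    have "subspace (closure (span B))" by (intro subspace_closure subspace_span)
    from closest_point_subspace[OF this closed_closure, of x]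
    obtain y where y: "y \<in> closure (span B)" "\<And>z. z \<in> closure (span B) \<Longrightarrow> (x - y) \<bullet> z = 0"
      by blast
    have "x = y"
    proof (rule ccontr)
      assume xy: "x \<noteq> y"
      define u where "u = (1 / norm (x - y)) *\<^sub>R (x - y)"
      have u: "norm u = 1" using xy by (simp add: u_def)
      have orth: "u \<bullet> b = 0" if "b \<in> B" for b
        using y(2)[of b] closure_subset[of "span B"] span_base[OF that] by (auto simp: u_def)
      have "insert u B = B"
      proof (rule mx)
        show "pairwise orthogonal (insert u B)"
          unfolding pairwise_insert orthogonal_def
          using B(1) orth by (simp add: inner_commute orthogonal_def pairwise_def)
        show "\<forall>b\<in>insert u B. norm b = 1" using B(2) u by blast
      qed blast
      then have "u \<in> B" by blast
      then have "u \<bullet> u = 0" by (rule orth)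
      then show False using u by simp
    qed
    then show ?thesis using y by simp
  qed
  then have "orthonormal_basis B"
    using B by (simp add: orthonormal_basis_def set_eq_iff)
  then show ?thesis by (rule exI)
qed


lemma parseval_norm:
  assumes B: "orthonormal_basis B"
  shows "((\<lambda>b. (x \<bullet> b)\<^sup>2) has_sum (norm x)\<^sup>2) B"
proof -
  have on: "b \<bullet> c = (if b = c then 1 else 0)" if "b \<in> B" "c \<in> B" for b c
    using B that by (auto simp: orthonormal_basis_def pairwise_def orthogonal_def norm_eq_1)
  have *: "(norm (x - (\<Sum>b\<in>E. c b *\<^sub>R b)))\<^sup>2 =
      (norm x)\<^sup>2 - (\<Sum>b\<in>E. (x \<bullet> b)\<^sup>2) + (\<Sum>b\<in>E. (x \<bullet> b - c b)\<^sup>2)"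
    if E: "finite E" "E \<subseteq> B" for E c
  proof -
    have "(\<Sum>b\<in>E. c b *\<^sub>R b) \<bullet> d = c d" if "d \<in> E" for d
    proof -
      have "(\<Sum>b\<in>E. c b *\<^sub>R b) \<bullet> d = (\<Sum>b\<in>E. if b = d then c b else 0)"
        unfolding inner_sum_left using E that by (intro sum.cong) (auto simp: on subset_iff)
      then show ?thesis using E that by simp
    qed
    then have "(\<Sum>b\<in>E. c b *\<^sub>R b) \<bullet> (\<Sum>b\<in>E. c b *\<^sub>R b) = (\<Sum>b\<in>E. (c b)\<^sup>2)"
      by (subst inner_sum_right) (simp add: power2_eq_square)
    moreover have "x \<bullet> (\<Sum>b\<in>E. c b *\<^sub>R b) = (\<Sum>b\<in>E. c b * (x \<bullet> b))"
      by (simp add: inner_sum_right)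
    moreover have "(\<Sum>b\<in>E. (x \<bullet> b - c b)\<^sup>2) =
        (\<Sum>b\<in>E. (x \<bullet> b)\<^sup>2) - 2 * (\<Sum>b\<in>E. c b * (x \<bullet> b)) + (\<Sum>b\<in>E. (c b)\<^sup>2)"
      by (simp add: power2_diff sum.distrib sum_subtractf sum_distrib_left algebra_simps)
    ultimately show ?thesis
      by (simp add: power2_norm_eq_inner inner_diff_left inner_diff_right inner_commute)
  qed
  have bessel: "(\<Sum>b\<in>E. (x \<bullet> b)\<^sup>2) \<le> (norm x)\<^sup>2" if "finite E" "E \<subseteq> B" for E
    using *[OF that, of "\<lambda>b. x \<bullet> b"] zero_le_power2[of "norm (x - (\<Sum>b\<in>E. (x \<bullet> b) *\<^sub>R b))"] by simp
  show ?thesis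
    unfolding has_sum_def tendsto_iff eventually_finite_subsets_at_top
  proof (intro allI impI)
    fix e :: real assume e: "e > 0"
    have "x \<in> closure (span B)" using B by (simp add: orthonormal_basis_def)
    then obtain s where s: "s \<in> span B" "dist s x < sqrt e"
      using e closure_approachable real_sqrt_gt_zero by metis
    then obtain E c where E: "finite E" "E \<subseteq> B" and sE: "s = (\<Sum>b\<in>E. c b *\<^sub>R b)"
      by (auto simp: span_explicit)
    have "(norm (x - s))\<^sup>2 < (sqrt e)\<^sup>2"
      using s(2) by (intro power_strict_mono) (auto simp: dist_norm norm_minus_commute)
    then have lt: "(norm x)\<^sup>2 - (\<Sum>b\<in>E. (x \<bullet> b)\<^sup>2) < e"
      using *[OF E, of c] sum_nonneg[of E "\<lambda>b. (x \<bullet> b - c b)\<^sup>2"] e by (simp add: sE)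
    have "dist (\<Sum>b\<in>Y. (x \<bullet> b)\<^sup>2) ((norm x)\<^sup>2) < e" if Y: "finite Y" "E \<subseteq> Y" "Y \<subseteq> B" for Y
    proof -
      have "(\<Sum>b\<in>E. (x \<bullet> b)\<^sup>2) \<le> (\<Sum>b\<in>Y. (x \<bullet> b)\<^sup>2)" using Y by (intro sum_mono2) auto
      then show ?thesis using bessel[OF Y(1,3)] lt by (simp add: dist_real_def)
    qed
    then show "\<exists>X. finite X \<and> X \<subseteq> B \<and>
        (\<forall>Y. finite Y \<and> X \<subseteq> Y \<and> Y \<subseteq> B \<longrightarrow> dist (\<Sum>b\<in>Y. (x \<bullet> b)\<^sup>2) ((norm x)\<^sup>2) < e)"
      using E by blast
  qed
qed

lemma parseval_inner:
  assumes B: "orthonormal_basis B"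
  shows "((\<lambda>b. (x \<bullet> b) * (y \<bullet> b)) has_sum (x \<bullet> y)) B"
proof -
  have "((\<lambda>b. (1/4) * (((x + y) \<bullet> b)\<^sup>2 + (-1) * ((x - y) \<bullet> b)\<^sup>2))
      has_sum (1/4) * ((norm (x + y))\<^sup>2 + (-1) * (norm (x - y))\<^sup>2)) B"
    by (intro has_sum_cmult_right has_sum_add parseval_norm B)
  moreover have "(1/4) * ((norm (x + y))\<^sup>2 + (-1) * (norm (x - y))\<^sup>2) = x \<bullet> y"
    by (simp add: power2_norm_eq_inner inner_add_left inner_add_right
        inner_diff_left inner_diff_right inner_commute)
  moreover have "(1/4) * (((x + y) \<bullet> b)\<^sup>2 + (-1) * ((x - y) \<bullet> b)\<^sup>2) = (x \<bullet> b) * (y \<bullet> b)" for b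
    by (simp add: inner_add_left inner_diff_left power2_eq_square algebra_simps)
  ultimately show ?thesis by (simp only:)
qed

lemma onb: "orthonormal_basis (onb :: 'k::{real_inner, complete_space} set)"
  unfolding onb_def by (rule someI_ex[of orthonormal_basis, OF orthonormal_basis_exists])

lemma onb_tuples_Suc:
  "onb_tuples (Suc n) = (\<lambda>(b, xs). b # xs) ` (onb \<times> (onb_tuples n :: 'k::real_inner list set))"
proof (intro equalityI subsetI)
  fix xs :: "'k list"
  assume "xs \<in> onb_tuples (Suc n)"
  then show "xs \<in> (\<lambda>(b, xs). b # xs) ` (onb \<times> onb_tuples n)"
    by (cases xs) (simp_all add: onb_tuples_def image_iff)
next
  fix xs :: "'k list"
  assume "xs \<in> (\<lambda>(b, xs). b # xs) ` (onb \<times> onb_tuples n)"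
  then show "xs \<in> onb_tuples (Suc n)" by (force simp: onb_tuples_def)
qed

lemma elementary_tensor_Cons:
  "elementary_tensor (f # fs) (x # xs) = (f \<bullet> x) * elementary_tensor fs xs"
  by (simp add: elementary_tensor_def prod.lessThan_Suc_shift del: prod.lessThan_Suc)

lemma elementary_tensor_has_sum:
  fixes fs gs :: "'k::{real_inner, complete_space} list"
  assumes "length gs = length fs"
  shows "((\<lambda>xs. elementary_tensor fs xs * elementary_tensor gs xs)
    has_sum (\<Prod>i<length fs. (fs ! i) \<bullet> (gs ! i))) (onb_tuples (length fs))"
  using assms[symmetric]
proof (induction fs gs rule: list_induct2)
  case Nil
  have "onb_tuples 0 = {[] :: 'k list}" by (auto simp: onb_tuples_def)
  moreover have "((\<lambda>xs. elementary_tensor [] xs * elementary_tensor [] xs) has_sum 1) {[] :: 'k list}"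
    by (rule has_sum_finiteI) (simp_all add: elementary_tensor_def)
  ultimately show ?case by simp
next
  case (Cons f fs g gs)
  let ?u = "\<lambda>b. (f \<bullet> b) * (g \<bullet> b)"
  let ?v = "\<lambda>xs. elementary_tensor fs xs * elementary_tensor gs xs"
  let ?n = "length fs"
  let ?p = "\<Prod>i<?n. (fs ! i) \<bullet> (gs ! i)"
  have u: "(?u has_sum (f \<bullet> g)) onb" by (rule parseval_inner[OF onb])
  have v: "(?v has_sum ?p) (onb_tuples ?n)" by (rule Cons.IH)
  define p q where "p = ?u" and "q = ?v"
  have ua: "(\<lambda>b. norm (p b)) summable_on onb"
    unfolding p_def
    by (rule summable_on_iff_abs_summable_on_real[THEN iffD1]) (rule has_sum_imp_summable[OF u])
  have va: "(\<lambda>xs. norm (q xs)) summable_on onb_tuples ?n"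
    unfolding q_def
    by (rule summable_on_iff_abs_summable_on_real[THEN iffD1]) (rule has_sum_imp_summable[OF v])
  have "(\<lambda>z. norm (p (fst z) * q (snd z))) summable_on onb \<times> onb_tuples ?n"
    unfolding Infinite_Sum.abs_summable_on_Sigma_iff
    unfolding fst_conv snd_conv norm_mult infsum_cmult_right'
    using ua va
    by (auto intro!: summable_on_cmult_left summable_on_cmult_right simp: abs_mult)
  then have sm: "(\<lambda>z. p (fst z) * q (snd z)) summable_on onb \<times> onb_tuples ?n"
    by (rule summable_on_iff_abs_summable_on_real[THEN iffD2])
  have "((\<lambda>z. p (fst z) * q (snd z)) has_sum ((f \<bullet> g) * ?p)) (onb \<times> onb_tuples ?n)"
  proof (rule has_sum_SigmaI[OF _ _ sm])
    show "((\<lambda>xs. p (fst (b, xs)) * q (snd (b, xs))) has_sum (p b * ?p)) (onb_tuples ?n)" for b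
      unfolding fst_conv snd_conv q_def by (rule has_sum_cmult_right[OF v])
    show "((\<lambda>b. p b * ?p) has_sum ((f \<bullet> g) * ?p)) onb"
      unfolding p_def by (rule has_sum_cmult_left[OF u])
  qed
  moreover have "inj_on (\<lambda>(b, xs). b # xs) (onb \<times> (onb_tuples ?n :: 'k list set))"
    by (auto simp: inj_on_def)
  moreover have "(\<lambda>xs. elementary_tensor (f # fs) xs * elementary_tensor (g # gs) xs) \<circ>
      (\<lambda>(b, xs). b # xs) = (\<lambda>z. p (fst z) * q (snd z))"
    by (simp add: fun_eq_iff elementary_tensor_Cons p_def q_def)
  ultimately have "((\<lambda>xs. elementary_tensor (f # fs) xs * elementary_tensor (g # gs) xs)
      has_sum ((f \<bullet> g) * ?p)) ((\<lambda>(b, xs). b # xs) ` (onb \<times> onb_tuples ?n))"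
    by (simp only: has_sum_reindex)
  moreover have "(\<Prod>i<length (f # fs). ((f # fs) ! i) \<bullet> ((g # gs) ! i)) = (f \<bullet> g) * ?p"
    unfolding length_Cons prod.lessThan_Suc_shift by simp
  ultimately show ?case
    by (simp only: length_Cons onb_tuples_Suc)
qed

lemma tensor_inner_elementary_tensor:
  fixes fs gs :: "'k::{real_inner, complete_space} list"
  assumes "length fs = n" "length gs = n"
  shows "tensor_inner n (elementary_tensor fs) (elementary_tensor gs) = (\<Prod>i<n. (fs ! i) \<bullet> (gs ! i))"
  using infsumI[OF elementary_tensor_has_sum[of gs fs]] assms by (simp add: tensor_inner_def)

lemma elementary_tensor_in_tensor_power:
  "elementary_tensor (fs :: 'k::{real_inner, complete_space} list) \<in> tensor_power (length fs)"
proof -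
  have "linear (\<lambda>x. \<Prod>j<length fs. (fs ! j) \<bullet> (xs[i := x] ! j))"
    if "i < length fs" "length xs = length fs" for xs :: "'k list" and i
  proof -
    have "(\<Prod>j<length fs. (fs ! j) \<bullet> (xs[i := x] ! j)) =
        (fs ! i \<bullet> x) * (\<Prod>j\<in>{..<length fs} - {i}. (fs ! j) \<bullet> (xs ! j))" for x
      using that by (subst prod.remove[of _ i]) (auto intro!: prod.cong)
    then show ?thesis
      by (auto intro!: linearI simp: inner_add_right algebra_simps)
  qed
  moreover have "\<bar>\<Prod>i<length fs. (fs ! i) \<bullet> (xs ! i)\<bar> \<le>
      (\<Prod>i<length fs. norm (fs ! i)) * (\<Prod>i<length fs. norm (xs ! i))" for xs
    unfolding abs_prod prod.distrib[symmetric]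
    by (intro prod_mono) (auto simp: Cauchy_Schwarz_ineq2)
  ultimately have "multilinear_functional (length fs) (elementary_tensor fs)"
    unfolding multilinear_functional_def elementary_tensor_def by (auto cong: if_cong)
  moreover have "(\<lambda>xs. (elementary_tensor fs xs)\<^sup>2) summable_on onb_tuples (length fs)"
    using elementary_tensor_has_sum[of fs fs] by (auto simp: has_sum_iff power2_eq_square)
  ultimately show ?thesis by (simp add: tensor_power_def)
qed

end

theory Submission
  imports Defs
begin

text \<open>
  The theorem is the Banach algebra statement that \<open>\<Sum>\<^sub>k a\<^sub>k F\<^sup>k\<close> converges when the norm of \<open>F\<close> is
  less than the radius of convergence. The Fock space norms are not submultiplicative, so the point
  is to find a norm that is, that makes \<open>F\<close> small enough, and that dominates the norm of one of the
  spaces in the inductive limit.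

  On tensors of degree \<open>n\<close> take \<open>q_norm\<close>, which is \<open>\<parallel>P\<^sub>q f\<parallel> / [n]!\<close>. Writing a permutation of \<open>m + n\<close> letters
  as a word and cutting it after \<open>m\<close> letters expresses \<open>P\<^sub>q (f \<otimes> g)\<close> as a sum of rearrangements of
  \<open>P\<^sub>q f \<otimes> P\<^sub>q g\<close>, one for each \<open>m\<close>-element set of positions (\<open>Pq_tensor_mult\<close>). The moduli of the coefficients
  add up to the Gaussian binomial coefficient \<open>[m + n]! / ([m]! [n]!)\<close> (\<open>q_binomial_sum\<close>), and rearranging
  arguments preserves the Hilbert-Schmidt norm. Hence
  \<open>q_norm (f \<otimes> g) \<le> q_norm f * q_norm g\<close> (\<open>q_norm_tensor_mult_le\<close>).

  Consequently the weighted \<open>\<ell>\<^sup>1\<close> norm \<open>\<Sum>\<^sub>n w\<^sup>n q_norm F\<^sub>n\<close> is submultiplicative. Its degree zero term is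
  \<open>\<bar>F\<^sub>0\<bar> < R\<close>, whereas the other terms can be made as small as desired by lowering \<open>w\<close>
  (\<open>small_fock_partial_norm\<close>); so the norm is at most some \<open>s < R\<close>, and \<open>\<Sum>\<^sub>k \<bar>a\<^sub>k\<bar> s\<^sup>k\<close> majorises the series.
  Since the \<open>\<ell>\<^sup>2\<close> norm is at most the \<open>\<ell>\<^sup>1\<close> norm, the series converges in the Fock space with
  weight \<open>r = w\<^sup>-\<^sup>2\<close> (\<open>power_series_in_fock\<close>).

  The limit must also consist of honest tensors in each degree. For this, \<open>F = F\<^sub>0 \<Omega> + G\<close> with \<open>G\<close>
  free of a degree zero part, and the binomial theorem writes the degree \<open>n\<close> part of every power of \<open>F\<close>
  as a combination of those of \<open>G\<^sup>0, \<dots>, G\<^sup>n\<close> (\<open>fock_power_binomial\<close>). The limit in degree \<open>n\<close> is therefore a finite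
  combination of tensors.
\<close>

section \<open>Permutations as words and their inversions\<close>

definition inversions :: "nat list \<Rightarrow> nat"
  where "inversions L = num_inversions (length L) ((!) L)"

definition cross_inversions :: "nat set \<Rightarrow> nat set \<Rightarrow> nat"
  where "cross_inversions A B = card {(a, b). a \<in> A \<and> b \<in> B \<and> b < a}"

lemma inversions_append:
  assumes "distinct L" "distinct M"
  shows "inversions (L @ M) = inversions L + inversions M + cross_inversions (set L) (set M)"
proof -
  let ?m = "length L" and ?n = "length M"
  define X where "X = {(i, j). i < j \<and> j < ?m \<and> L ! i > L ! j}"
  define Y where "Y = {(i, j). i < j \<and> j < ?n \<and> M ! i > M ! j}"
  define Z where "Z = {(i, j). i < ?m \<and> j < ?n \<and> L ! i > M ! j}"
  have fin: "finite X" "finite Y" "finite Z"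
    by (rule finite_subset[of _ "{..<?m} \<times> {..<?m}"], auto simp: X_def)
      (rule finite_subset[of _ "{..<?n} \<times> {..<?n}"], auto simp: Y_def,
       rule finite_subset[of _ "{..<?m} \<times> {..<?n}"], auto simp: Z_def)
  let ?y = "\<lambda>(i, j). (?m + i, ?m + j)" and ?z = "\<lambda>(i, j). (i, ?m + j)"
  have "{(i, j). i < j \<and> j < ?m + ?n \<and> (L @ M) ! i > (L @ M) ! j} = X \<union> ?y ` Y \<union> ?z ` Z"
    (is "?I = ?U")
  proof (intro equalityI subrelI)
    fix i j assume ij: "(i, j) \<in> ?I"
    consider "j < ?m" | "i < ?m" "\<not> j < ?m" | "\<not> i < ?m" by blast
    then show "(i, j) \<in> ?U"
    proof cases
      case 1
      then show ?thesis using ij by (auto simp: X_def nth_append)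
    next
      case 2
      then have "(i, j - ?m) \<in> Z" "(i, j) = ?z (i, j - ?m)"
        using ij by (auto simp: Z_def nth_append)
      then show ?thesis by blast
    next
      case 3
      then have "(i - ?m, j - ?m) \<in> Y" "(i, j) = ?y (i - ?m, j - ?m)"
        using ij by (auto simp: Y_def nth_append)
      then show ?thesis by blast
    qed
  qed (auto simp: X_def Y_def Z_def nth_append)
  then have "inversions (L @ M) = card (X \<union> ?y ` Y \<union> ?z ` Z)"
    by (simp add: inversions_def num_inversions_def)
  also have "\<dots> = card (X \<union> ?y ` Y) + card (?z ` Z)"
    by (rule card_Un_disjoint) (use fin in \<open>auto simp: X_def Y_def Z_def\<close>)
  also have "card (X \<union> ?y ` Y) = card X + card (?y ` Y)"
    by (rule card_Un_disjoint) (use fin in \<open>auto simp: X_def Y_def\<close>)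
  also have "card (?y ` Y) = card Y" by (rule card_image) (auto simp: inj_on_def)
  also have "card (?z ` Z) = card Z" by (rule card_image) (auto simp: inj_on_def)
  also have "card Z = card ((\<lambda>(i, j). (L ! i, M ! j)) ` Z)"
    by (rule card_image[symmetric])
      (use assms in \<open>auto simp: inj_on_def Z_def nth_eq_iff_index_eq\<close>)
  also have "(\<lambda>(i, j). (L ! i, M ! j)) ` Z = {(a, b). a \<in> set L \<and> b \<in> set M \<and> b < a}"
  proof (intro equalityI subrelI)
    fix a b assume "(a, b) \<in> {(a, b). a \<in> set L \<and> b \<in> set M \<and> b < a}"
    then obtain i j where "i < ?m" "L ! i = a" "j < ?n" "M ! j = b" "b < a"
      by (auto simp: in_set_conv_nth)
    then show "(a, b) \<in> (\<lambda>(i, j). (L ! i, M ! j)) ` Z"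
      by (intro image_eqI[of _ _ "(i, j)"]) (auto simp: Z_def)
  qed (auto simp: Z_def)
  finally show ?thesis
    by (simp add: inversions_def num_inversions_def cross_inversions_def X_def Y_def)
qed

text \<open>
  Only the relative order of the entries matters for inversions; this is what allows the words
  over an arbitrary finite set of positions to be replaced by permutations of an initial segment.
\<close>

lemma inversions_map:
  assumes "strict_mono_on (set L) f"
  shows "inversions (map f L) = inversions L"
proof -
  have "f (L ! j) < f (L ! i) \<longleftrightarrow> L ! j < L ! i" if "i < length L" "j < length L" for i j
    using assms that by (intro strict_mono_on_less) auto
  then have "{(i, j). i < j \<and> j < length L \<and> f (L ! j) < f (L ! i)} =
      {(i, j). i < j \<and> j < length L \<and> L ! j < L ! i}"
    by (auto intro: order.strict_trans)
  moreover have "inversions (map f L) = card {(i, j). i < j \<and> j < length L \<and> f (L ! j) < f (L ! i)}"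
    unfolding inversions_def num_inversions_def
    by (intro arg_cong[of _ _ card]) (auto simp: order.strict_trans)
  ultimately show ?thesis
    by (simp add: inversions_def num_inversions_def)
qed

text \<open>
  Permutations are written as words (duplicate-free lists), because splitting a permutation of
  \<open>{..<m + n}\<close> after its first \<open>m\<close> values is then merely cutting a list in two.
\<close>

definition q_sum :: "real \<Rightarrow> nat set \<Rightarrow> (nat list \<Rightarrow> real) \<Rightarrow> real"
  where "q_sum q A h = (\<Sum>L\<in>permutations_of_set A. q ^ inversions L * h L)"

text \<open>
  A word over \<open>X\<close> is determined by the set \<open>A\<close> of its first \<open>m\<close> letters, a word over \<open>A\<close> and a
  word over the rest. Its inversions are those of the two halves plus the pairs with a letter from
  \<open>A\<close> that exceeds a letter from \<open>X - A\<close>; the last number depends on \<open>A\<close> alone. The sum of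
  \<open>q\<^bsup>inv\<^esup>\<close> over all words therefore factorises for each \<open>A\<close>. The minimum covers the case in which
  \<open>take m\<close> returns the whole word.
\<close>

lemma q_sum_split:
  assumes "finite X"
  shows "q_sum q X (\<lambda>L. f (take m L) * g (drop m L)) =
    (\<Sum>A | A \<subseteq> X \<and> card A = min m (card X).
      q ^ cross_inversions A (X - A) * (q_sum q A f * q_sum q (X - A) g))"
proof -
  let ?S = "{A. A \<subseteq> X \<and> card A = min m (card X)}"
  have finS: "finite ?S" using assms by simp
  have "q_sum q X (\<lambda>L. f (take m L) * g (drop m L)) =
    (\<Sum>(A, L, M) \<in> (SIGMA A:?S. permutations_of_set A \<times> permutations_of_set (X - A)).
      q ^ cross_inversions A (X - A) * ((q ^ inversions L * f L) * (q ^ inversions M * g M)))"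
    unfolding q_sum_def
  proof (rule sum.reindex_bij_witness
      [where i = "\<lambda>(A, L, M). L @ M" and j = "\<lambda>L. (set (take m L), take m L, drop m L)"])
    fix L assume "L \<in> permutations_of_set X"
    then have L: "set L = X" "distinct L" "length L = card X"
      by (auto simp: permutations_of_set_def distinct_card)
    have disj: "set (take m L) \<inter> set (drop m L) = {}"
      using L(2) by (rule set_take_disj_set_drop_if_distinct) simp
    have un: "set (take m L) \<union> set (drop m L) = X"
      using L(1) by (metis append_take_drop_id set_append)
    have d: "X - set (take m L) = set (drop m L)" using disj un by blast
    show "(set (take m L), take m L, drop m L)
        \<in> (SIGMA A:?S. permutations_of_set A \<times> permutations_of_set (X - A))"
      using L d un distinct_card[OF distinct_take[OF L(2), of m]]
      by (auto simp: permutations_of_set_def min.commute)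
    show "(case (set (take m L), take m L, drop m L) of (A, L, M) \<Rightarrow>
        q ^ cross_inversions A (X - A) * ((q ^ inversions L * f L) * (q ^ inversions M * g M))) =
        q ^ inversions L * (f (take m L) * g (drop m L))"
      using inversions_append[of "take m L" "drop m L"] L(2) d
      by (simp add: power_add mult_ac)
  next
    fix p assume p: "p \<in> (SIGMA A:?S. permutations_of_set A \<times> permutations_of_set (X - A))"
    obtain A L M where pA: "p = (A, L, M)" by (metis prod_cases3)
    have A: "A \<subseteq> X" "card A = min m (card X)" and LM: "set L = A" "distinct L" "set M = X - A" "distinct M"
      using p by (auto simp: pA permutations_of_set_def)
    have len: "length L = min m (card X)" "length M = card X - min m (card X)"
      using A LM assms distinct_card[of L] distinct_card[of M] card_Diff_subset[of A X]
        finite_subset[OF A(1) assms] by auto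
    then have "take m (L @ M) = L" "drop m (L @ M) = M"
      by (cases "m \<le> card X"; simp)+
    then show "(\<lambda>L. (set (take m L), take m L, drop m L)) (case p of (A, L, M) \<Rightarrow> L @ M) = p"
      using LM by (simp add: pA)
    show "(case p of (A, L, M) \<Rightarrow> L @ M) \<in> permutations_of_set X"
      using LM A by (auto simp: pA permutations_of_set_def)
  qed auto
  also have "\<dots> = (\<Sum>A\<in>?S. \<Sum>(L, M)\<in>permutations_of_set A \<times> permutations_of_set (X - A).
      q ^ cross_inversions A (X - A) * ((q ^ inversions L * f L) * (q ^ inversions M * g M)))"
    by (rule sum.Sigma[symmetric]) (use finS in auto)
  also have "\<dots> = (\<Sum>A\<in>?S. q ^ cross_inversions A (X - A) * (q_sum q A f * q_sum q (X - A) g))"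
    unfolding q_sum_def sum_product
    by (intro sum.cong) (simp_all add: sum.cartesian_product sum_distrib_left case_prod_unfold)
  finally show ?thesis .
qed

lemma q_sum_reindex:
  assumes "finite A"
  shows "q_sum q A h = q_sum q {..<card A} (\<lambda>L. h (map ((!) (sorted_list_of_set A)) L))"
proof -
  let ?e = "(!) (sorted_list_of_set A)"
  have mono: "strict_mono_on {..<card A} ?e"
    by (rule strict_mono_onI) (auto simp: sorted_wrt_nth_less[OF strict_sorted_list_of_set])
  have inj: "inj_on ?e {..<card A}" by (rule strict_mono_on_imp_inj_on[OF mono])
  have im: "?e ` {..<card A} = A"
    using assms nth_image[of "card A" "sorted_list_of_set A"]
    by (simp add: atLeast0LessThan)
  have "q_sum q A h = (\<Sum>L\<in>map ?e ` permutations_of_set {..<card A}. q ^ inversions L * h L)"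
    unfolding q_sum_def using permutations_of_set_image_inj[OF inj] im by simp
  also have "\<dots> = (\<Sum>L\<in>permutations_of_set {..<card A}. q ^ inversions (map ?e L) * h (map ?e L))"
  proof (rule sum.reindex[unfolded comp_def])
    show "inj_on (map ?e) (permutations_of_set {..<card A})"
      using inj by (intro inj_onI) (auto simp: permutations_of_set_def map_inj_on dest!: map_inj_on)
  qed
  also have "\<dots> = q_sum q {..<card A} (\<lambda>L. h (map ?e L))"
    unfolding q_sum_def
    by (intro sum.cong refl) (auto simp: permutations_of_set_def inversions_map mono)
  finally show ?thesis .
qed

text \<open>
  The sorted enumeration is the relabelling of \<open>q_sum_reindex\<close>. In this form \<open>nths\<close> can be recognised
  as the list of arguments that a word over \<open>A\<close> permutes.
\<close>

lemma nths_eq_map_nth: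
  "nths xs A = map ((!) xs) (sorted_list_of_set (A \<inter> {..<length xs}))"
proof -
  let ?n = "length xs"
  have "nths xs A = nths (map ((!) xs) [0..<?n]) A" by (simp add: map_nth)
  also have "\<dots> = map ((!) xs) (nths [0..<?n] A)" by (rule nths_map)
  also have "nths [0..<?n] A = filter (\<lambda>i. i \<in> A) [0..<?n]"
    by (simp add: nths_def zip_same_conv_map filter_map comp_def)
  also have "\<dots> = sorted_list_of_set (A \<inter> {..<?n})"
    by (rule sorted_distinct_set_unique) (auto intro: sorted_wrt_filter)
  finally show ?thesis .
qed

section \<open>The action of \<open>P\<^sub>q\<close> on tensor products\<close>

text \<open>
  The operator permutes by the inverse of \<open>\<pi>\<close> but weights by the inversions of \<open>\<pi>\<close>. The two
  fit together because \<open>(i, j) \<mapsto> (\<pi> j, \<pi> i)\<close> maps the inversions of \<open>\<pi>\<close> bijectively onto those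
  of its inverse.
\<close>

lemma Pq_eq_q_sum:
  assumes "length xs = n"
  shows "Pq q n f xs = q_sum q {..<n} (\<lambda>L. f (map ((!) xs) L))"
proof -
  have inv: "num_inversions n (inv \<pi>) = num_inversions n \<pi>" if "\<pi> permutes {..<n}" for \<pi>
    unfolding num_inversions_def
  proof (rule bij_betw_same_card[symmetric])
    let ?A = "\<lambda>p. {(i, j). i < j \<and> j < n \<and> p j < (p i :: nat)}"
    have lt: "p i < n" if "p permutes {..<n}" "i < n" for p i
      using permutes_in_image[OF that(1), of i] that(2) by simp
    have im: "(\<lambda>(i, j). (p j, p i)) ` ?A p \<subseteq> ?A (inv p)" if p: "p permutes {..<n}" for p
    proof (intro subrelI)
      fix a b assume "(a, b) \<in> (\<lambda>(i, j). (p j, p i)) ` ?A p"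
      then obtain i j where "i < j" "j < n" "p j < p i" "a = p j" "b = p i" by auto
      then show "(a, b) \<in> ?A (inv p)"
        using lt[OF p, of i] by (simp add: permutes_inverses[OF p])
    qed
    show "bij_betw (\<lambda>(i, j). (\<pi> j, \<pi> i)) (?A \<pi>) (?A (inv \<pi>))"
    proof (rule bij_betw_byWitness[where f' = "\<lambda>(i, j). (inv \<pi> j, inv \<pi> i)"])
      show "(\<lambda>(i, j). (inv \<pi> j, inv \<pi> i)) ` ?A (inv \<pi>) \<subseteq> ?A \<pi>"
        using im[OF permutes_inv[OF that]] permutes_inv_inv[OF that] by simp
      show "(\<lambda>(i, j). (\<pi> j, \<pi> i)) ` ?A \<pi> \<subseteq> ?A (inv \<pi>)" by (rule im[OF that])
    qed (auto simp: permutes_inverses[OF that])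
  qed
  have "Pq q n f xs = (\<Sum>\<pi> | \<pi> permutes {..<n}. q ^ num_inversions n (inv \<pi>) * f (permute_list (inv \<pi>) xs))"
    using assms inv by (auto simp: Pq_def intro!: sum.cong)
  also have "\<dots> = (\<Sum>\<pi> | \<pi> permutes {..<n}. q ^ num_inversions n \<pi> * f (permute_list \<pi> xs))"
    by (rule sum.reindex_bij_witness[where i = inv and j = inv])
      (auto simp: permutes_inv permutes_inv_inv)
  also have "\<dots> = q_sum q {..<n} (\<lambda>L. f (map ((!) xs) L))"
    unfolding q_sum_def
  proof (rule sum.reindex_bij_witness
      [where i = "\<lambda>L i. if i < n then L ! i else i" and j = "\<lambda>\<pi>. map \<pi> [0..<n]"])
    fix \<pi> assume "\<pi> \<in> {\<pi>. \<pi> permutes {..<n}}"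
    then have p: "\<pi> permutes {..<n}" by simp
    show "(\<lambda>i. if i < n then map \<pi> [0..<n] ! i else i) = \<pi>"
      by (rule ext) (simp add: permutes_not_in[OF p])
    show "map \<pi> [0..<n] \<in> permutations_of_set {..<n}"
      using permutes_image[OF p] permutes_inj_on[OF p, of "{..<n}"]
      by (simp add: permutations_of_set_def distinct_map atLeast0LessThan)
    have "num_inversions n ((!) (map \<pi> [0..<n])) = num_inversions n \<pi>"
      unfolding num_inversions_def by (rule arg_cong[of _ _ card]) auto
    moreover have "map ((!) xs) (map \<pi> [0..<n]) = permute_list \<pi> xs"
      using assms by (simp add: permute_list_def)
    ultimately show "q ^ inversions (map \<pi> [0..<n]) * f (map ((!) xs) (map \<pi> [0..<n])) =
        q ^ num_inversions n \<pi> * f (permute_list \<pi> xs)"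
      by (simp add: inversions_def)
  next
    fix L assume "L \<in> permutations_of_set {..<n}"
    then have L: "set L = {..<n}" "distinct L" "length L = n"
      using distinct_card[of L] by (auto simp: permutations_of_set_def)
    show "map (\<lambda>i. if i < n then L ! i else i) [0..<n] = L"
      using L(3) by (intro nth_equalityI) simp_all
    have "bij_betw ((!) L) {..<n} {..<n}" using bij_betw_nth[OF L(2)] L by simp
    then have "bij_betw (\<lambda>i. if i < n then L ! i else i) {..<n} {..<n}"
      by (rule bij_betw_cong[THEN iffD1, rotated]) simp
    then show "(\<lambda>i. if i < n then L ! i else i) \<in> {\<pi>. \<pi> permutes {..<n}}"
      unfolding mem_Collect_eq by (rule bij_imp_permutes) simp
  qed
  finally show ?thesis .
qed

lemma q_sum_eq_Pq_nths:
  assumes "A \<subseteq> {..<length xs}"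
  shows "q_sum q A (\<lambda>L. f (map ((!) xs) L)) = Pq q (card A) f (nths xs A)"
proof -
  have fin: "finite A" using assms finite_subset by blast
  have e: "nths xs A = map ((!) xs) (sorted_list_of_set A)"
    using nths_eq_map_nth[of xs A] assms by (simp add: Int_absorb2)
  have "q_sum q A (\<lambda>L. f (map ((!) xs) L)) =
      q_sum q {..<card A} (\<lambda>L. f (map ((!) xs) (map ((!) (sorted_list_of_set A)) L)))"
    by (rule q_sum_reindex[OF fin])
  also have "\<dots> = q_sum q {..<card A} (\<lambda>L. f (map ((!) (nths xs A)) L))"
    unfolding q_sum_def
  proof (intro sum.cong refl arg_cong2[where f = "(*)"] arg_cong[where f = f])
    fix L assume "L \<in> permutations_of_set {..<card A}"
    then show "map ((!) xs) (map ((!) (sorted_list_of_set A)) L) = map ((!) (nths xs A)) L"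
      by (auto simp: e permutations_of_set_def)
  qed
  also have "\<dots> = Pq q (card A) f (nths xs A)"
    by (rule Pq_eq_q_sum[symmetric]) (simp add: e)
  finally show ?thesis .
qed

text \<open>
  This is the factorisation \<open>P\<^sup>(\<^sup>m\<^sup>+\<^sup>n\<^sup>) = R (P\<^sup>(\<^sup>m\<^sup>) \<otimes> P\<^sup>(\<^sup>n\<^sup>))\<close> over the coset representatives of
  \<open>S\<^sub>m \<times> S\<^sub>n\<close> in \<open>S\<^sub>m\<^sub>+\<^sub>n\<close>: the representatives correspond to the sets \<open>A\<close>, and each acts on
  functionals by rearranging the arguments.
\<close>

lemma Pq_tensor_mult:
  assumes "length xs = m + n"
  shows "Pq q (m + n) (tensor_mult m n f g) xs =
    (\<Sum>A | A \<subseteq> {..<m + n} \<and> card A = m. q ^ cross_inversions A ({..<m + n} - A) *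
      (Pq q m f (nths xs A) * Pq q n g (nths xs ({..<m + n} - A))))"
proof -
  let ?X = "{..<m + n}"
  have "Pq q (m + n) (tensor_mult m n f g) xs =
      q_sum q ?X (\<lambda>L. f (map ((!) xs) (take m L)) * g (map ((!) xs) (drop m L)))"
    unfolding Pq_eq_q_sum[OF assms] q_sum_def
  proof (intro sum.cong refl arg_cong2[where f = "(*)"])
    fix L assume "L \<in> permutations_of_set ?X"
    then have "length L = m + n" using length_finite_permutations_of_set by fastforce
    then show "tensor_mult m n f g (map ((!) xs) L) =
        f (map ((!) xs) (take m L)) * g (map ((!) xs) (drop m L))"
      by (simp add: tensor_mult_def take_map drop_map)
  qed
  also have "\<dots> = (\<Sum>A | A \<subseteq> ?X \<and> card A = m. q ^ cross_inversions A (?X - A) *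
      (q_sum q A (\<lambda>L. f (map ((!) xs) L)) * q_sum q (?X - A) (\<lambda>L. g (map ((!) xs) L))))"
    by (subst q_sum_split) auto
  also have "\<dots> = (\<Sum>A | A \<subseteq> ?X \<and> card A = m. q ^ cross_inversions A (?X - A) *
      (Pq q m f (nths xs A) * Pq q n g (nths xs (?X - A))))"
  proof (intro sum.cong refl)
    fix A assume "A \<in> {A. A \<subseteq> ?X \<and> card A = m}"
    then have A: "A \<subseteq> ?X" "card A = m" "card (?X - A) = n"
      by (auto simp: card_Diff_subset finite_subset)
    show "q ^ cross_inversions A (?X - A) *
      (q_sum q A (\<lambda>L. f (map ((!) xs) L)) * q_sum q (?X - A) (\<lambda>L. g (map ((!) xs) L))) =
      q ^ cross_inversions A (?X - A) * (Pq q m f (nths xs A) * Pq q n g (nths xs (?X - A)))"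
      using q_sum_eq_Pq_nths[of A xs] q_sum_eq_Pq_nths[of "?X - A" xs] A assms by simp
  qed
  finally show ?thesis .
qed

text \<open>
  Splitting off the first letter \<open>a\<close> of a word contributes \<open>\<bar>q\<bar>\<^sup>a\<close>, hence a factor \<open>[n + 1]\<close> at
  each step: the inversion generating function of the symmetric group is the \<open>q\<close>-factorial.
\<close>

lemma q_sum_abs_one:
  assumes "finite A"
  shows "q_sum \<bar>q\<bar> A (\<lambda>_. 1) = q_factorial q (card A)"
proof -
  have "q_sum \<bar>q\<bar> {..<n} (\<lambda>_. 1) = q_factorial q n" for n
  proof (induction n)
    case 0
    then show ?case
      by (simp add: q_sum_def q_factorial_def inversions_def num_inversions_def)
  next
    case (Suc n)
    have "q_sum \<bar>q\<bar> {..<Suc n} (\<lambda>_. 1) =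
       (\<Sum>A | A \<subseteq> {..<Suc n} \<and> card A = 1. \<bar>q\<bar> ^ cross_inversions A ({..<Suc n} - A) *
         (q_sum \<bar>q\<bar> A (\<lambda>_. 1) * q_sum \<bar>q\<bar> ({..<Suc n} - A) (\<lambda>_. 1)))"
      using q_sum_split[of "{..<Suc n}" "\<bar>q\<bar>" "\<lambda>_. 1" 1 "\<lambda>_. 1"] by simp
    also have "\<dots> = (\<Sum>a<Suc n. \<bar>q\<bar> ^ a * q_factorial q n)"
    proof (rule sum.reindex_bij_witness[where i = "\<lambda>a. {a}" and j = the_elem])
      fix A assume "A \<in> {A. A \<subseteq> {..<Suc n} \<and> card A = 1}"
      then obtain a where a: "A = {a}" "a < Suc n" by (auto simp: card_1_singleton_iff)
      then show "{the_elem A} = A" "the_elem A \<in> {..<Suc n}" by auto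
      have "{(x, b). x \<in> {a} \<and> b \<in> {..<Suc n} - {a} \<and> b < x} = {a} \<times> {..<a}" using a by auto
      then have "cross_inversions {a} ({..<Suc n} - {a}) = a"
        by (simp add: cross_inversions_def)
      moreover have "inversions [a] = 0"
        unfolding inversions_def num_inversions_def by (auto simp: card_eq_0_iff)
      then have "q_sum \<bar>q\<bar> {a} (\<lambda>_. 1) = 1"
        by (simp add: q_sum_def)
      moreover have "card ({..<Suc n} - {a}) = n" using a by simp
      then have "q_sum \<bar>q\<bar> ({..<Suc n} - {a}) (\<lambda>_. 1) = q_factorial q n"
        by (subst q_sum_reindex) (simp_all only: Suc finite_Diff finite_lessThan)
      ultimately show "\<bar>q\<bar> ^ the_elem A * q_factorial q n = \<bar>q\<bar> ^ cross_inversions A ({..<Suc n} - A) *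
         (q_sum \<bar>q\<bar> A (\<lambda>_. 1) * q_sum \<bar>q\<bar> ({..<Suc n} - A) (\<lambda>_. 1))"
        by (simp add: a)
    qed auto
    also have "\<dots> = q_factorial q (Suc n)"
      by (simp only: sum_distrib_right[symmetric]) (simp add: q_factorial_def q_number_def)
    finally show ?case .
  qed
  then show ?thesis by (subst q_sum_reindex[OF assms])
qed

lemma q_factorial_pos: "q_factorial q n > 0"
proof -
  have "q_number q k > 0" if "k \<ge> 1" for k
    unfolding q_number_def by (rule sum_pos2[of _ 0]) (use that in auto)
  then show ?thesis unfolding q_factorial_def by (intro prod_pos) auto
qed

text \<open>
  The Gaussian binomial coefficient as generating function of subsets, obtained by counting
  all permutations in two ways. It bounds the norm of the operator \<open>R\<close> above.
\<close>

lemma q_binomial_sum: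
  "(\<Sum>A | A \<subseteq> {..<m + n} \<and> card A = m. \<bar>q\<bar> ^ cross_inversions A ({..<m + n} - A)) =
    q_factorial q (m + n) / (q_factorial q m * q_factorial q n)"
proof -
  let ?X = "{..<m + n}" let ?S = "{A. A \<subseteq> ?X \<and> card A = m}"
  have "q_factorial q (m + n) = q_sum \<bar>q\<bar> ?X (\<lambda>_. 1 * 1)" using q_sum_abs_one[of ?X q] by simp
  also have "\<dots> = (\<Sum>A\<in>?S. \<bar>q\<bar> ^ cross_inversions A (?X - A) *
      (q_sum \<bar>q\<bar> A (\<lambda>_. 1) * q_sum \<bar>q\<bar> (?X - A) (\<lambda>_. 1)))"
    using q_sum_split[of ?X "\<bar>q\<bar>" "\<lambda>_. 1" m "\<lambda>_. 1"] by simp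
  also have "\<dots> = (\<Sum>A\<in>?S. \<bar>q\<bar> ^ cross_inversions A (?X - A) * (q_factorial q m * q_factorial q n))"
    by (intro sum.cong refl) (auto simp: q_sum_abs_one card_Diff_subset finite_subset)
  finally show ?thesis
    using q_factorial_pos[of q m] q_factorial_pos[of q n]
    by (simp add: sum_distrib_right[symmetric])
qed

section \<open>Bounds on \<open>\<ell>\<^sup>2\<close> norms\<close>

text \<open>
  The bound \<open>c\<close> on the \<open>\<ell>\<^sup>2\<close> norm is expressed through finite partial sums only. In this form it
  passes to pointwise limits and needs no summability side conditions.
\<close>

definition l2_bounded :: "'a set \<Rightarrow> ('a \<Rightarrow> real) \<Rightarrow> real \<Rightarrow> bool"
  where "l2_bounded S f c \<longleftrightarrow> (\<forall>E. finite E \<longrightarrow> E \<subseteq> S \<longrightarrow> L2_set f E \<le> c)"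

lemma l2_boundedI: "(\<And>E. finite E \<Longrightarrow> E \<subseteq> S \<Longrightarrow> L2_set f E \<le> c) \<Longrightarrow> l2_bounded S f c"
  by (simp add: l2_bounded_def)

lemma l2_boundedD: "l2_bounded S f c \<Longrightarrow> finite E \<Longrightarrow> E \<subseteq> S \<Longrightarrow> L2_set f E \<le> c"
  by (simp add: l2_bounded_def)

lemma l2_bounded_cong:
  assumes "\<And>x. x \<in> S \<Longrightarrow> f x = g x"
  shows "l2_bounded S f c \<longleftrightarrow> l2_bounded S g c"
  unfolding l2_bounded_def using assms by (metis L2_set_cong subsetD)

lemma l2_bounded_nonneg: "l2_bounded S f c \<Longrightarrow> 0 \<le> c"
  using l2_boundedD[of S f c "{}"] by simp

lemma l2_bounded_sum_le:
  assumes "l2_bounded S f c" "finite E" "E \<subseteq> S"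
  shows "(\<Sum>x\<in>E. (f x)\<^sup>2) \<le> c\<^sup>2"
  using power_mono[OF l2_boundedD[OF assms], of 2] by (simp add: L2_set_def sum_nonneg)

lemma l2_bounded_summable:
  assumes "l2_bounded S f c"
  shows "(\<lambda>x. (f x)\<^sup>2) summable_on S"
  by (rule nonneg_bdd_above_summable_on)
    (auto intro!: bdd_aboveI[where M = "c\<^sup>2"] l2_bounded_sum_le[OF assms])

lemma l2_bounded_infsum_le:
  assumes "l2_bounded S f c"
  shows "(\<Sum>\<^sub>\<infinity>x\<in>S. (f x)\<^sup>2) \<le> c\<^sup>2"
  by (rule infsum_le_finite_sums) (auto intro: l2_bounded_summable l2_bounded_sum_le assms)

lemma l2_bounded_sqrt_infsum:
  assumes "(\<lambda>x. (f x)\<^sup>2) summable_on S"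
  shows "l2_bounded S f (sqrt (\<Sum>\<^sub>\<infinity>x\<in>S. (f x)\<^sup>2))"
  unfolding L2_set_def l2_bounded_def
  by (auto intro!: finite_sum_le_infsum assms)

lemma l2_bounded_reindex:
  assumes "l2_bounded T f c" "inj_on u S" "u ` S \<subseteq> T"
  shows "l2_bounded S (\<lambda>x. f (u x)) c"
proof (rule l2_boundedI)
  fix E assume E: "finite E" "E \<subseteq> S"
  then have "L2_set (\<lambda>x. f (u x)) E = L2_set f (u ` E)"
    using assms(2) by (simp add: L2_set_def sum.reindex inj_on_subset)
  also have "\<dots> \<le> c" using E assms by (intro l2_boundedD[OF assms(1)]) auto
  finally show "L2_set (\<lambda>x. f (u x)) E \<le> c" .
qed

text \<open>
  The norm of a tensor product. The maps \<open>u\<close> and \<open>v\<close> split an index into two; since they are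
  jointly injective, the sum over \<open>S\<close> is dominated by a product of two sums.
\<close>

lemma l2_bounded_product:
  assumes f: "l2_bounded T f c" and g: "l2_bounded U g d"
    and inj: "inj_on (\<lambda>x. (u x, v x)) S" and "u ` S \<subseteq> T" "v ` S \<subseteq> U"
  shows "l2_bounded S (\<lambda>x. f (u x) * g (v x)) (c * d)"
proof (rule l2_boundedI)
  fix E assume E: "finite E" "E \<subseteq> S"
  have "(\<Sum>x\<in>E. (f (u x) * g (v x))\<^sup>2) = (\<Sum>(y, z)\<in>(\<lambda>x. (u x, v x)) ` E. (f y)\<^sup>2 * (g z)\<^sup>2)"
    using inj_on_subset[OF inj E(2)] by (simp add: sum.reindex power_mult_distrib)
  also have "\<dots> \<le> (\<Sum>(y, z)\<in>u ` E \<times> v ` E. (f y)\<^sup>2 * (g z)\<^sup>2)"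
    using E by (intro sum_mono2) auto
  also have "\<dots> = (\<Sum>y\<in>u ` E. (f y)\<^sup>2) * (\<Sum>z\<in>v ` E. (g z)\<^sup>2)"
    by (simp add: sum_product sum.cartesian_product)
  also have "\<dots> \<le> c\<^sup>2 * d\<^sup>2"
    using E assms(4,5) by (intro mult_mono l2_bounded_sum_le[OF f] l2_bounded_sum_le[OF g]) (auto intro: sum_nonneg)
  finally show "L2_set (\<lambda>x. f (u x) * g (v x)) E \<le> c * d"
    using l2_bounded_nonneg[OF f] l2_bounded_nonneg[OF g]
    by (auto simp: L2_set_def power_mult_distrib intro!: real_le_lsqrt sum_nonneg)
qed

lemma l2_bounded_sum:
  assumes "finite T" "\<And>i. i \<in> T \<Longrightarrow> l2_bounded S (f i) (c i)"
  shows "l2_bounded S (\<lambda>x. \<Sum>i\<in>T. a i * f i x) (\<Sum>i\<in>T. \<bar>a i\<bar> * c i)"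
  using assms
proof (induction T rule: finite_induct)
  case empty
  then show ?case by (simp add: l2_bounded_def L2_set_def)
next
  case (insert i T)
  show ?case
  proof (rule l2_boundedI)
    fix E assume E: "finite E" "E \<subseteq> S"
    have "L2_set (\<lambda>x. \<Sum>i\<in>insert i T. a i * f i x) E =
        L2_set (\<lambda>x. a i * f i x + (\<Sum>i\<in>T. a i * f i x)) E"
      using insert.hyps by simp
    also have "\<dots> \<le> L2_set (\<lambda>x. a i * f i x) E + L2_set (\<lambda>x. \<Sum>i\<in>T. a i * f i x) E"
      by (rule L2_set_triangle_ineq)
    also have "L2_set (\<lambda>x. a i * f i x) E = \<bar>a i\<bar> * L2_set (f i) E"
      by (simp add: L2_set_def power_mult_distrib sum_distrib_left[symmetric] real_sqrt_mult)
    also have "\<bar>a i\<bar> * L2_set (f i) E + L2_set (\<lambda>x. \<Sum>i\<in>T. a i * f i x) E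
        \<le> \<bar>a i\<bar> * c i + (\<Sum>i\<in>T. \<bar>a i\<bar> * c i)"
      using E insert by (intro add_mono mult_left_mono) (auto intro: l2_boundedD)
    finally show "L2_set (\<lambda>x. \<Sum>i\<in>insert i T. a i * f i x) E \<le> (\<Sum>i\<in>insert i T. \<bar>a i\<bar> * c i)"
      using insert.hyps by simp
  qed
qed

text \<open>
  A Fatou argument: the finite partial sums of the series obey the triangle inequality, and the
  bound survives the pointwise limit on each finite set.
\<close>

lemma l2_bounded_sums:
  fixes f :: "nat \<Rightarrow> 'a \<Rightarrow> real"
  assumes f: "\<And>k. l2_bounded S (f k) (c k)" and "summable (\<lambda>k. \<bar>a k\<bar> * c k)"
    and g: "\<And>x. x \<in> S \<Longrightarrow> (\<lambda>k. a k * f k x) sums g x"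
  shows "l2_bounded S g (\<Sum>k. \<bar>a k\<bar> * c k)"
proof (rule l2_boundedI)
  fix E assume E: "finite E" "E \<subseteq> S"
  have "(\<lambda>N. L2_set (\<lambda>x. \<Sum>k<N. a k * f k x) E) \<longlonglongrightarrow> L2_set g E"
    unfolding L2_set_def using g E by (intro tendsto_intros) (auto simp: sums_def)
  moreover have "L2_set (\<lambda>x. \<Sum>k<N. a k * f k x) E \<le> (\<Sum>k. \<bar>a k\<bar> * c k)" for N
  proof -
    have "L2_set (\<lambda>x. \<Sum>k<N. a k * f k x) E \<le> (\<Sum>k<N. \<bar>a k\<bar> * c k)"
      by (rule l2_boundedD[OF l2_bounded_sum E]) (auto intro: f)
    also have "\<dots> \<le> (\<Sum>k. \<bar>a k\<bar> * c k)"
      using assms(2) l2_bounded_nonneg[OF f] by (intro sum_le_suminf) auto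
    finally show ?thesis .
  qed
  ultimately show "L2_set g E \<le> (\<Sum>k. \<bar>a k\<bar> * c k)"
    by (intro LIMSEQ_le_const2) auto
qed

section \<open>The normalised norm of homogeneous tensors\<close>

text \<open>
  The norm of \<open>F\<^sub>q\<^sup>(\<^sup>n\<^sup>)(K)\<close> divided by the \<open>q\<close>-factorial. The weight exponent \<open>-2\<close> amounts to this
  normalisation, under which the norm is submultiplicative for the tensor product.
\<close>

definition q_norm :: "real \<Rightarrow> nat \<Rightarrow> ('k::real_inner) tensor \<Rightarrow> real"
  where "q_norm q n f = sqrt (q_inner q n f f) / q_factorial q n"

lemma q_inner_self: "q_inner q n f f = (\<Sum>\<^sub>\<infinity>xs\<in>onb_tuples n. (Pq q n f xs)\<^sup>2)"
  by (simp add: q_inner_def tensor_inner_def power2_eq_square)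

lemma q_inner_nonneg: "q_inner q n f f \<ge> 0"
  unfolding q_inner_self by (rule infsum_nonneg) simp

lemma q_norm_nonneg: "q_norm q n f \<ge> 0"
  using q_inner_nonneg[of q n f] q_factorial_pos[of q n] by (simp add: q_norm_def)

lemma q_norm_leI:
  assumes "l2_bounded (onb_tuples n) (Pq q n f) (c * q_factorial q n)"
  shows "q_norm q n f \<le> c"
proof -
  have "sqrt (q_inner q n f f) \<le> c * q_factorial q n"
    unfolding q_inner_self using l2_bounded_infsum_le[OF assms] l2_bounded_nonneg[OF assms]
    by (intro real_le_lsqrt) auto
  then show ?thesis using q_factorial_pos[of q n] by (simp add: q_norm_def field_simps)
qed

lemma permute_list_onb_tuples:
  assumes "\<pi> permutes {..<n}"
  shows "inj_on (permute_list \<pi>) (onb_tuples n :: 'k::real_inner list set)"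
    and "permute_list \<pi> ` onb_tuples n \<subseteq> (onb_tuples n :: 'k list set)"
proof -
  show "inj_on (permute_list \<pi>) (onb_tuples n :: 'k list set)"
  proof (rule inj_on_inverseI)
    fix xs :: "'k list" assume "xs \<in> onb_tuples n"
    then have "permute_list (\<pi> \<circ> inv \<pi>) xs = permute_list (inv \<pi>) (permute_list \<pi> xs)"
      using permutes_inv[OF assms] by (intro permute_list_compose) (simp add: onb_tuples_def)
    then show "permute_list (inv \<pi>) (permute_list \<pi> xs) = xs"
      by (simp add: permutes_inv_o(1)[OF assms])
  qed
  show "permute_list \<pi> ` onb_tuples n \<subseteq> (onb_tuples n :: 'k list set)"
    using assms by (auto simp: onb_tuples_def set_permute_list)
qed

text \<open>
  Permuting the arguments is a bijection of the basis tuples, so \<open>P\<^sub>q f\<close> is a finite sum of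
  square-summable functions and its norm is given by a convergent sum.
\<close>

lemma Pq_l2_bounded:
  assumes "f \<in> tensor_power n"
  shows "l2_bounded (onb_tuples n) (Pq q n f) (q_norm q n f * q_factorial q n)"
proof -
  define c where "c = sqrt (\<Sum>\<^sub>\<infinity>xs\<in>onb_tuples n. (f xs)\<^sup>2)"
  have f: "l2_bounded (onb_tuples n) f c"
    unfolding c_def using assms by (intro l2_bounded_sqrt_infsum) (simp add: tensor_power_def)
  have "l2_bounded (onb_tuples n)
      (\<lambda>xs. \<Sum>\<pi> | \<pi> permutes {..<n}. q ^ num_inversions n \<pi> * f (permute_list (inv \<pi>) xs))
      (\<Sum>\<pi> | \<pi> permutes {..<n}. \<bar>q ^ num_inversions n \<pi>\<bar> * c)" (is "l2_bounded _ ?P ?b")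
  proof (rule l2_bounded_sum)
    show "finite {\<pi>. \<pi> permutes {..<n}}" by (simp add: finite_permutations)
    fix \<pi> assume "\<pi> \<in> {\<pi>. \<pi> permutes {..<n}}"
    then have "inv \<pi> permutes {..<n}" by (simp add: permutes_inv)
    then show "l2_bounded (onb_tuples n) (\<lambda>xs. f (permute_list (inv \<pi>) xs)) c"
      by (intro l2_bounded_reindex[OF f] permute_list_onb_tuples)
  qed
  then have "(\<lambda>xs. (?P xs)\<^sup>2) summable_on onb_tuples n" by (rule l2_bounded_summable)
  then have "(\<lambda>xs. (Pq q n f xs)\<^sup>2) summable_on onb_tuples n"
    by (rule summable_on_cong[THEN iffD1, rotated]) (simp add: Pq_def onb_tuples_def)
  then have "l2_bounded (onb_tuples n) (Pq q n f) (sqrt (q_inner q n f f))"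
    unfolding q_inner_self by (rule l2_bounded_sqrt_infsum)
  moreover have "q_norm q n f * q_factorial q n = sqrt (q_inner q n f f)"
    using q_factorial_pos[of q n] by (simp add: q_norm_def)
  ultimately show ?thesis by simp
qed

lemma nths_onb_tuples:
  assumes "A \<subseteq> {..<N}"
  shows "(\<lambda>xs. nths xs A) ` onb_tuples N \<subseteq> onb_tuples (card A)"
proof -
  have "{i. i < N \<and> i \<in> A} = A" using assms by auto
  then show ?thesis
    by (auto simp: onb_tuples_def length_nths dest: in_set_nthsD)
qed

text \<open>
  A list is recovered from its subwords at the positions in \<open>A\<close> and outside \<open>A\<close>, so each term of
  \<open>Pq_tensor_mult\<close> has the norm of a genuine tensor product.
\<close>

lemma inj_on_nths_pair:
  "inj_on (\<lambda>xs. (nths xs A, nths xs ({..<N} - A))) {xs. length xs = N}"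
proof (rule inj_onI, clarsimp)
  fix xs ys :: "'a list"
  assume eq: "nths xs A = nths ys A" "nths xs ({..<length xs} - A) = nths ys ({..<length xs} - A)"
    and len: "length ys = length xs"
  have "xs ! i = ys ! i" if "i < length xs" for i
  proof (cases "i \<in> A")
    case True
    have "\<forall>j\<in>set (sorted_list_of_set (A \<inter> {..<length xs})). xs ! j = ys ! j"
      using eq(1) len unfolding nths_eq_map_nth by (simp add: map_eq_conv)
    then show ?thesis using True that by simp
  next
    case False
    have "\<forall>j\<in>set (sorted_list_of_set (({..<length xs} - A) \<inter> {..<length xs})). xs ! j = ys ! j"
      using eq(2) len unfolding nths_eq_map_nth by (simp add: map_eq_conv)
    then show ?thesis using False that by simp
  qed
  then show "xs = ys" using len by (simp add: list_eq_iff_nth_eq)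
qed

text \<open>
  Each of the sets \<open>A\<close> contributes at most \<open>\<bar>q\<bar>\<close> to the power of its crossings times
  \<open>\<parallel>P\<^sub>q f\<parallel> \<parallel>P\<^sub>q g\<parallel>\<close>. The sum of these powers is the Gaussian binomial coefficient
  \<open>[m + n]! / ([m]! [n]!)\<close>, which the normalisation cancels.
\<close>

lemma q_norm_tensor_mult_le:
  assumes f: "f \<in> tensor_power m" and g: "g \<in> tensor_power n"
  shows "q_norm q (m + n) (tensor_mult m n f g) \<le> q_norm q m f * q_norm q n g"
proof (rule q_norm_leI)
  let ?X = "{..<m + n}" let ?S = "{A. A \<subseteq> ?X \<and> card A = m}"
  let ?b = "(q_norm q m f * q_factorial q m) * (q_norm q n g * q_factorial q n)"
  have "l2_bounded (onb_tuples (m + n))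
      (\<lambda>xs. \<Sum>A\<in>?S. q ^ cross_inversions A (?X - A) *
        (Pq q m f (nths xs A) * Pq q n g (nths xs (?X - A))))
      (\<Sum>A\<in>?S. \<bar>q ^ cross_inversions A (?X - A)\<bar> * ?b)" (is "l2_bounded _ ?h ?c")
  proof (rule l2_bounded_sum)
    fix A assume "A \<in> ?S"
    then have A: "A \<subseteq> ?X" "card A = m" "card (?X - A) = n"
      by (auto simp: card_Diff_subset finite_subset)
    show "l2_bounded (onb_tuples (m + n)) (\<lambda>xs. Pq q m f (nths xs A) * Pq q n g (nths xs (?X - A))) ?b"
    proof (rule l2_bounded_product[OF Pq_l2_bounded[OF f] Pq_l2_bounded[OF g]])
      show "inj_on (\<lambda>xs. (nths xs A, nths xs (?X - A))) (onb_tuples (m + n))"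
        by (rule inj_on_subset[OF inj_on_nths_pair]) (auto simp: onb_tuples_def)
    qed (use A nths_onb_tuples[of A "m + n"] nths_onb_tuples[of "?X - A" "m + n"] in auto)
  qed auto
  moreover have "?c = q_norm q m f * q_norm q n g * q_factorial q (m + n)"
    using q_factorial_pos[of q m] q_factorial_pos[of q n]
    unfolding sum_distrib_right[symmetric] power_abs q_binomial_sum by simp
  ultimately have "l2_bounded (onb_tuples (m + n)) ?h (q_norm q m f * q_norm q n g * q_factorial q (m + n))"
    by simp
  moreover have "?h xs = Pq q (m + n) (tensor_mult m n f g) xs" if "xs \<in> onb_tuples (m + n)" for xs
    using that by (simp add: Pq_tensor_mult onb_tuples_def)
  ultimately show "l2_bounded (onb_tuples (m + n)) (Pq q (m + n) (tensor_mult m n f g))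
      (q_norm q m f * q_norm q n g * q_factorial q (m + n))"
    by (rule l2_bounded_cong[THEN iffD1, rotated])
qed

lemma Pq_sums:
  assumes "\<And>xs. (\<lambda>k. b k * f k xs) sums g xs"
  shows "(\<lambda>k. b k * Pq q n (f k) xs) sums Pq q n g xs"
proof (cases "length xs = n")
  case True
  have "(\<lambda>k. \<Sum>\<pi> | \<pi> permutes {..<n}. q ^ num_inversions n \<pi> * (b k * f k (permute_list (inv \<pi>) xs)))
      sums (\<Sum>\<pi> | \<pi> permutes {..<n}. q ^ num_inversions n \<pi> * g (permute_list (inv \<pi>) xs))"
    by (intro sums_sum sums_mult assms)
  then show ?thesis using True by (simp add: Pq_def sum_distrib_left mult_ac)
qed (simp add: Pq_def)

text \<open>
  The triangle inequality for a series that converges only pointwise, as functionals. \<open>P\<^sub>q\<close>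
  evaluates its argument at finitely many tuples and so commutes with pointwise limits.
\<close>

lemma q_norm_sums_le:
  fixes f :: "nat \<Rightarrow> 'k::real_inner tensor"
  assumes f: "\<And>k. f k \<in> tensor_power n" and sm: "summable (\<lambda>k. \<bar>b k\<bar> * q_norm q n (f k))"
    and g: "\<And>xs. (\<lambda>k. b k * f k xs) sums g xs"
  shows "q_norm q n g \<le> (\<Sum>k. \<bar>b k\<bar> * q_norm q n (f k))"
proof (rule q_norm_leI)
  have "l2_bounded (onb_tuples n) (Pq q n g) (\<Sum>k. \<bar>b k\<bar> * (q_norm q n (f k) * q_factorial q n))"
  proof (rule l2_bounded_sums)
    show "l2_bounded (onb_tuples n) (Pq q n (f k)) (q_norm q n (f k) * q_factorial q n)" for k
      by (rule Pq_l2_bounded[OF f])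
    show "summable (\<lambda>k. \<bar>b k\<bar> * (q_norm q n (f k) * q_factorial q n))"
      using summable_mult2[OF sm, of "q_factorial q n"] by (simp add: mult_ac)
    show "(\<lambda>k. b k * Pq q n (f k) xs) sums Pq q n g xs" for xs
      by (rule Pq_sums[OF g])
  qed
  then show "l2_bounded (onb_tuples n) (Pq q n g) ((\<Sum>k. \<bar>b k\<bar> * q_norm q n (f k)) * q_factorial q n)"
    using suminf_mult2[OF sm, of "q_factorial q n"] by (simp add: mult_ac)
qed

lemma q_norm_sum_le:
  fixes f :: "'i \<Rightarrow> 'k::real_inner tensor"
  assumes "finite T" and f: "\<And>i. i \<in> T \<Longrightarrow> f i \<in> tensor_power n"
  shows "q_norm q n (\<lambda>xs. \<Sum>i\<in>T. f i xs) \<le> (\<Sum>i\<in>T. q_norm q n (f i))"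
proof (rule q_norm_leI)
  have "l2_bounded (onb_tuples n) (\<lambda>xs. \<Sum>i\<in>T. 1 * Pq q n (f i) xs)
      (\<Sum>i\<in>T. \<bar>1\<bar> * (q_norm q n (f i) * q_factorial q n))"
    by (intro l2_bounded_sum assms(1) Pq_l2_bounded f)
  moreover have "(\<lambda>xs. \<Sum>i\<in>T. 1 * Pq q n (f i) xs) = Pq q n (\<lambda>xs. \<Sum>i\<in>T. f i xs)"
  proof
    fix xs
    show "(\<Sum>i\<in>T. 1 * Pq q n (f i) xs) = Pq q n (\<lambda>xs. \<Sum>i\<in>T. f i xs) xs"
      unfolding Pq_def by (auto simp: sum_distrib_left intro: sum.swap)
  qed
  ultimately show "l2_bounded (onb_tuples n) (Pq q n (\<lambda>xs. \<Sum>i\<in>T. f i xs))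
      ((\<Sum>i\<in>T. q_norm q n (f i)) * q_factorial q n)"
    by (simp add: sum_distrib_right)
qed

section \<open>Closure properties of the tensor powers\<close>

lemma tensor_powerD_length: "f \<in> tensor_power n \<Longrightarrow> length xs \<noteq> n \<Longrightarrow> f xs = 0"
  by (auto simp: tensor_power_def multilinear_functional_def)

lemma tensor_power_linear_combination:
  fixes f :: "'i \<Rightarrow> 'k::real_inner tensor"
  assumes T: "finite T" and f: "\<And>i. i \<in> T \<Longrightarrow> f i \<in> tensor_power n"
  shows "(\<lambda>xs. \<Sum>i\<in>T. c i * f i xs) \<in> tensor_power n"
proof -
  have ml: "multilinear_functional n (f i)" if "i \<in> T" for i
    using f[OF that] by (simp add: tensor_power_def)
  have "\<exists>C. \<forall>xs. length xs = n \<longrightarrow> \<bar>f i xs\<bar> \<le> C * (\<Prod>j<n. norm (xs ! j))" if "i \<in> T" for i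
    using ml[OF that] by (simp add: multilinear_functional_def)
  then obtain C where C: "\<And>i xs. i \<in> T \<Longrightarrow> length xs = n \<Longrightarrow> \<bar>f i xs\<bar> \<le> C i * (\<Prod>j<n. norm (xs ! j))"
    by metis
  have "multilinear_functional n (\<lambda>xs. \<Sum>i\<in>T. c i * f i xs)"
    unfolding multilinear_functional_def
  proof (intro conjI allI impI exI)
    fix xs :: "'k list" assume "length xs \<noteq> n"
    then show "(\<Sum>i\<in>T. c i * f i xs) = 0"
      using f tensor_powerD_length by (intro sum.neutral) auto
  next
    fix xs :: "'k list" and j assume "length xs = n" "j < n"
    then have "linear (\<lambda>x. f i (xs[j := x]))" if "i \<in> T" for i
      using ml[OF that] by (simp add: multilinear_functional_def)
    then have "linear (\<lambda>x. c i *\<^sub>R f i (xs[j := x]))" if "i \<in> T" for i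
      using that by (intro linear_compose_scale_right) auto
    then show "linear (\<lambda>x. \<Sum>i\<in>T. c i * f i (xs[j := x]))"
      using linear_compose_sum[of T "\<lambda>i x. c i *\<^sub>R f i (xs[j := x])"] by simp
  next
    fix xs :: "'k list" assume len: "length xs = n"
    have "\<bar>\<Sum>i\<in>T. c i * f i xs\<bar> \<le> (\<Sum>i\<in>T. \<bar>c i * f i xs\<bar>)" by (rule sum_abs)
    also have "\<dots> \<le> (\<Sum>i\<in>T. \<bar>c i\<bar> * (C i * (\<Prod>j<n. norm (xs ! j))))"
      unfolding abs_mult by (intro sum_mono mult_left_mono C len) auto
    also have "\<dots> = (\<Sum>i\<in>T. \<bar>c i\<bar> * C i) * (\<Prod>j<n. norm (xs ! j))"
      by (simp add: sum_distrib_right mult.assoc)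
    finally show "\<bar>\<Sum>i\<in>T. c i * f i xs\<bar> \<le> (\<Sum>i\<in>T. \<bar>c i\<bar> * C i) * (\<Prod>j<n. norm (xs ! j))" .
  qed
  moreover have "l2_bounded (onb_tuples n) (\<lambda>xs. \<Sum>i\<in>T. c i * f i xs)
      (\<Sum>i\<in>T. \<bar>c i\<bar> * sqrt (\<Sum>\<^sub>\<infinity>xs\<in>onb_tuples n. (f i xs)\<^sup>2))"
    using f by (intro l2_bounded_sum T l2_bounded_sqrt_infsum) (auto simp: tensor_power_def)
  ultimately show ?thesis
    by (simp add: tensor_power_def l2_bounded_summable)
qed

lemma tensor_mult_in_tensor_power:
  fixes f g :: "'k::real_inner tensor"
  assumes f: "f \<in> tensor_power m" and g: "g \<in> tensor_power n"
  shows "tensor_mult m n f g \<in> tensor_power (m + n)"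
proof -
  have mf: "multilinear_functional m f" and mg: "multilinear_functional n g"
    using f g by (simp_all add: tensor_power_def)
  obtain C where C: "\<And>xs. length xs = m \<Longrightarrow> \<bar>f xs\<bar> \<le> C * (\<Prod>j<m. norm (xs ! j))"
    using mf by (auto simp: multilinear_functional_def)
  obtain D where D: "\<And>xs. length xs = n \<Longrightarrow> \<bar>g xs\<bar> \<le> D * (\<Prod>j<n. norm (xs ! j))"
    using mg by (auto simp: multilinear_functional_def)
  have prod_split: "(\<Prod>j<m + n. h j) = (\<Prod>j<m. h j) * (\<Prod>j<n. h (m + j))" for h :: "nat \<Rightarrow> real"
    by (induction n) (auto simp: mult_ac)
  have "multilinear_functional (m + n) (tensor_mult m n f g)"
    unfolding multilinear_functional_def
  proof (intro conjI allI impI exI)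
    show "length xs \<noteq> m + n \<Longrightarrow> tensor_mult m n f g xs = 0" for xs
      by (simp add: tensor_mult_def)
  next
    fix xs :: "'k list" and j assume len: "length xs = m + n" and j: "j < m + n"
    show "linear (\<lambda>x. tensor_mult m n f g (xs[j := x]))"
    proof (cases "j < m")
      case True
      have "linear (\<lambda>x. f ((take m xs)[j := x]))"
        using mf True len by (simp add: multilinear_functional_def)
      then have "linear (\<lambda>x. g (drop m xs) *\<^sub>R f ((take m xs)[j := x]))"
        by (rule linear_compose_scale_right)
      then show ?thesis
        using True len by (simp add: tensor_mult_def take_update_swap drop_update_cancel mult.commute)
    next
      case False
      have "linear (\<lambda>x. g ((drop m xs)[j - m := x]))"
        using mg False len j by (simp add: multilinear_functional_def)
      then have "linear (\<lambda>x. f (take m xs) *\<^sub>R g ((drop m xs)[j - m := x]))"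
        by (rule linear_compose_scale_right)
      then show ?thesis
        using False len by (simp add: tensor_mult_def drop_update_swap)
    qed
  next
    fix xs :: "'k list" assume len: "length xs = m + n"
    have "\<bar>f (take m xs)\<bar> * \<bar>g (drop m xs)\<bar> \<le>
        (C * (\<Prod>j<m. norm (take m xs ! j))) * (D * (\<Prod>j<n. norm (drop m xs ! j)))"
      using C[of "take m xs"] D[of "drop m xs"] len
      by (intro mult_mono) (auto intro: order.trans[OF abs_ge_zero])
    also have "(\<Prod>j<m. norm (take m xs ! j)) = (\<Prod>j<m. norm (xs ! j))"
      by (intro prod.cong) auto
    also have "(\<Prod>j<n. norm (drop m xs ! j)) = (\<Prod>j<n. norm (xs ! (m + j)))"
      using len by (intro prod.cong) auto
    also have "(C * (\<Prod>j<m. norm (xs ! j))) * (D * (\<Prod>j<n. norm (xs ! (m + j)))) =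
        (C * D) * (\<Prod>j<m + n. norm (xs ! j))"
      by (simp add: prod_split mult_ac)
    finally show "\<bar>tensor_mult m n f g xs\<bar> \<le> (C * D) * (\<Prod>j<m + n. norm (xs ! j))"
      using len by (simp add: tensor_mult_def abs_mult)
  qed
  moreover have "(\<lambda>xs. (tensor_mult m n f g xs)\<^sup>2) summable_on onb_tuples (m + n)"
  proof -
    have "l2_bounded (onb_tuples (m + n)) (\<lambda>xs. f (take m xs) * g (drop m xs))
        (sqrt (\<Sum>\<^sub>\<infinity>xs\<in>onb_tuples m. (f xs)\<^sup>2) * sqrt (\<Sum>\<^sub>\<infinity>xs\<in>onb_tuples n. (g xs)\<^sup>2))"
    proof (rule l2_bounded_product[where f = f and g = g and u = "take m" and v = "drop m"])
      show "inj_on (\<lambda>xs. (take m xs, drop m xs)) (onb_tuples (m + n) :: 'k list set)"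
        by (rule inj_onI) (metis append_take_drop_id prod.inject)
    qed (use f g in \<open>auto intro!: l2_bounded_sqrt_infsum simp: tensor_power_def onb_tuples_def
        dest: in_set_takeD in_set_dropD\<close>)
    then show ?thesis
      by (rule l2_bounded_summable[THEN summable_on_cong[THEN iffD1, rotated]])
        (simp add: tensor_mult_def onb_tuples_def)
  qed
  ultimately show ?thesis by (simp add: tensor_power_def)
qed

lemma tensor_power_zero: "(\<lambda>_. 0) \<in> tensor_power n"
  using tensor_power_linear_combination[of "{}" "\<lambda>_ _. 0"] by simp

lemma fock_mult_in_tensor_power:
  fixes F G :: "nat \<Rightarrow> 'k::real_inner tensor"
  assumes "\<And>n. F n \<in> tensor_power n" "\<And>n. G n \<in> tensor_power n"
  shows "fock_mult F G n \<in> tensor_power n"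
proof -
  have "(\<lambda>xs. \<Sum>i\<le>n. 1 * tensor_mult i (n - i) (F i) (G (n - i)) xs) \<in> tensor_power n"
  proof (rule tensor_power_linear_combination)
    show "tensor_mult i (n - i) (F i) (G (n - i)) \<in> tensor_power n" if "i \<in> {..n}" for i
      using tensor_mult_in_tensor_power[OF assms(1)[of i] assms(2)[of "n - i"]] that by simp
  qed simp
  then show ?thesis by (simp add: fock_mult_def)
qed

lemma vacuum_in_tensor_power: "vacuum n \<in> tensor_power n"
proof (cases "n = 0")
  case True
  have "multilinear_functional 0 (vacuum 0)"
    by (auto simp: multilinear_functional_def vacuum_def intro!: exI[of _ 1])
  moreover have "(\<lambda>xs. (vacuum 0 xs)\<^sup>2) summable_on onb_tuples 0"
    by (rule summable_on_finite) (simp add: onb_tuples_def cong: conj_cong)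
  ultimately show ?thesis using True by (simp add: tensor_power_def)
next
  case False
  then show ?thesis using tensor_power_zero[of n] by (simp add: vacuum_def)
qed

lemma fock_power_in_tensor_power:
  assumes "\<And>n. F n \<in> tensor_power n"
  shows "fock_power F k n \<in> tensor_power n"
  using assms
  by (induction k arbitrary: n) (auto intro: vacuum_in_tensor_power fock_mult_in_tensor_power)

section \<open>A submultiplicative norm on sequences of tensors\<close>

lemma q_norm_0: "q_norm q 0 f = \<bar>f []\<bar>"
proof -
  have "Pq q 0 f [] = f []"
    by (simp add: Pq_def num_inversions_def permutes_empty)
  moreover have "onb_tuples 0 = {[] :: 'a list}"
    by (auto simp: onb_tuples_def)
  ultimately have "q_inner q 0 f f = (f [])\<^sup>2" by (simp add: q_inner_self)
  then show ?thesis by (simp add: q_norm_def q_factorial_def)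
qed

lemma q_norm_zero: "q_norm q n (\<lambda>_::'k::real_inner list. 0) = 0"
proof -
  have "Pq q n (\<lambda>_::'k list. 0) = (\<lambda>_. 0)" by (simp add: Pq_def fun_eq_iff)
  then show ?thesis by (simp add: q_norm_def q_inner_self)
qed

text \<open>
  A weighted \<open>\<ell>\<^sup>1\<close> norm, truncated at degree \<open>M\<close>. Unlike the \<open>\<ell>\<^sup>2\<close> norm of the Fock space it is
  submultiplicative; truncation avoids convergence questions.
\<close>

definition fock_partial_norm :: "real \<Rightarrow> real \<Rightarrow> nat \<Rightarrow> (nat \<Rightarrow> ('k::real_inner) tensor) \<Rightarrow> real"
  where "fock_partial_norm q w M F = (\<Sum>n\<le>M. w ^ n * q_norm q n (F n))"

lemma fock_partial_norm_nonneg: "w \<ge> 0 \<Longrightarrow> fock_partial_norm q w M F \<ge> 0"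
  unfolding fock_partial_norm_def by (intro sum_nonneg mult_nonneg_nonneg q_norm_nonneg) simp

text \<open>
  The product is a Cauchy product of the graded components, and the pairs of degrees with sum at
  most \<open>M\<close> lie in the square \<open>{..M} \<times> {..M}\<close>.
\<close>

lemma fock_partial_norm_mult_le:
  assumes F: "\<And>n. F n \<in> tensor_power n" and G: "\<And>n. G n \<in> tensor_power n" and w: "w \<ge> 0"
  shows "fock_partial_norm q w M (fock_mult F G) \<le> fock_partial_norm q w M F * fock_partial_norm q w M G"
proof -
  define u v where "u = (\<lambda>n. w ^ n * q_norm q n (F n))" and "v = (\<lambda>n. w ^ n * q_norm q n (G n))"
  have pos: "u n \<ge> 0" "v n \<ge> 0" for n using w by (simp_all add: u_def v_def q_norm_nonneg)
  have "w ^ n * q_norm q n (fock_mult F G n) \<le> (\<Sum>i\<le>n. u i * v (n - i))" for n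
  proof -
    have "q_norm q n (fock_mult F G n) \<le>
        (\<Sum>i\<le>n. q_norm q n (tensor_mult i (n - i) (F i) (G (n - i))))"
      unfolding fock_mult_def
    proof (rule q_norm_sum_le)
      show "tensor_mult i (n - i) (F i) (G (n - i)) \<in> tensor_power n" if "i \<in> {..n}" for i
        using tensor_mult_in_tensor_power[OF F[of i] G[of "n - i"]] that by simp
    qed simp
    also have "\<dots> \<le> (\<Sum>i\<le>n. q_norm q i (F i) * q_norm q (n - i) (G (n - i)))"
    proof (rule sum_mono)
      fix i assume "i \<in> {..n}"
      then show "q_norm q n (tensor_mult i (n - i) (F i) (G (n - i))) \<le>
          q_norm q i (F i) * q_norm q (n - i) (G (n - i))"
        using q_norm_tensor_mult_le[OF F[of i] G[of "n - i"], of q] by simp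
    qed
    finally have "w ^ n * q_norm q n (fock_mult F G n) \<le>
        w ^ n * (\<Sum>i\<le>n. q_norm q i (F i) * q_norm q (n - i) (G (n - i)))"
      using w by (intro mult_left_mono) auto
    also have "\<dots> = (\<Sum>i\<le>n. u i * v (n - i))"
      unfolding sum_distrib_left
    proof (rule sum.cong)
      fix i assume "i \<in> {..n}"
      then have "w ^ n = w ^ i * w ^ (n - i)" by (simp add: power_add[symmetric])
      then show "w ^ n * (q_norm q i (F i) * q_norm q (n - i) (G (n - i))) = u i * v (n - i)"
        by (simp add: u_def v_def)
    qed simp
    finally show ?thesis .
  qed
  then have "fock_partial_norm q w M (fock_mult F G) \<le> (\<Sum>n\<le>M. \<Sum>i\<le>n. u i * v (n - i))"
    unfolding fock_partial_norm_def by (rule sum_mono)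
  also have "\<dots> = (\<Sum>(i, j)\<in>{(i, j). i + j \<le> M}. u i * v j)"
    by (rule sum.triangle_reindex_eq[symmetric])
  also have "\<dots> \<le> (\<Sum>(i, j)\<in>{..M} \<times> {..M}. u i * v j)"
    using pos by (intro sum_mono2) auto
  also have "\<dots> = fock_partial_norm q w M F * fock_partial_norm q w M G"
    by (simp add: fock_partial_norm_def u_def v_def sum_product sum.cartesian_product)
  finally show ?thesis .
qed

lemma fock_partial_norm_power_le:
  fixes F :: "nat \<Rightarrow> 'k::real_inner tensor"
  assumes F: "\<And>n. F n \<in> tensor_power n" and w: "w \<ge> 0" and s: "fock_partial_norm q w M F \<le> s"
  shows "fock_partial_norm q w M (fock_power F k) \<le> s ^ k"
proof (induction k)
  case 0
  have "q_norm q n (vacuum n :: 'k tensor) = (if n = 0 then 1 else 0)" for n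
    by (cases "n = 0") (simp_all add: q_norm_0 q_norm_zero vacuum_def[abs_def])
  then show ?case by (simp add: fock_partial_norm_def if_distrib[of "(*) _"] cong: if_cong)
next
  case (Suc k)
  have "fock_partial_norm q w M (fock_mult F (fock_power F k)) \<le>
      fock_partial_norm q w M F * fock_partial_norm q w M (fock_power F k)"
    by (rule fock_partial_norm_mult_le[OF F fock_power_in_tensor_power[OF F] w])
  also have "\<dots> \<le> s * s ^ k"
    using s Suc w by (intro mult_mono) (auto intro: fock_partial_norm_nonneg order.trans)
  finally show ?case by simp
qed

section \<open>Power series in a fixed degree\<close>

text \<open>
  Subtracting the degree zero component makes powers vanish in low degrees: the \<open>j\<close>-th power starts
  in degree \<open>j\<close>.
\<close>

definition without_constant :: "(nat \<Rightarrow> 'k tensor) \<Rightarrow> nat \<Rightarrow> 'k tensor"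
  where "without_constant F n = (if n = 0 then \<lambda>_. 0 else F n)"

lemma fock_power_without_constant_eq_0:
  "n < j \<Longrightarrow> fock_power (without_constant F) j n xs = 0"
proof (induction j arbitrary: n xs)
  case (Suc j)
  have "tensor_mult i (n - i) (without_constant F i) (fock_power (without_constant F) j (n - i)) xs = 0"
    if "i \<le> n" for i
  proof (cases "i = 0")
    case True
    then show ?thesis by (simp add: tensor_mult_def without_constant_def[of _ 0])
  next
    case False
    then have "n - i < j" using Suc.prems that by simp
    then show ?thesis by (simp add: tensor_mult_def Suc.IH)
  qed
  then show ?case by (simp add: fock_mult_def)
qed simp

lemma fock_mult_split_constant:
  assumes "H n \<in> tensor_power n"
  shows "fock_mult F H n xs = F 0 [] * H n xs + fock_mult (without_constant F) H n xs"
  using tensor_powerD_length[OF assms, of xs]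
  by (auto simp: fock_mult_def sum.atMost_shift tensor_mult_def without_constant_def)

text \<open>
  Binomial theorem for \<open>F = F\<^sub>0 \<Omega> + G\<close>. The sum stops at the degree \<open>n\<close> for every exponent \<open>k\<close>, so
  in a fixed degree all powers of \<open>F\<close> lie in the span of finitely many tensors.
\<close>

lemma fock_power_binomial:
  fixes F :: "nat \<Rightarrow> 'k::real_inner tensor"
  assumes F: "\<And>n. F n \<in> tensor_power n"
  shows "fock_power F k n xs =
    (\<Sum>j\<le>n. (of_nat (k choose j) * F 0 [] ^ (k - j)) * fock_power (without_constant F) j n xs)"
proof (induction k arbitrary: n xs)
  case 0
  show ?case by (simp add: sum.atMost_shift)
next
  case (Suc k)
  let ?G = "without_constant F"
  define c where "c k j = of_nat (k choose j) * F 0 [] ^ (k - j)" for k j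
  \<comment> \<open>Pascal's rule; for \<open>j \<ge> k\<close> the truncated exponent is harmless, as \<open>k choose Suc j\<close> vanishes.\<close>
  have rec: "c (Suc k) (Suc j) = F 0 [] * c k (Suc j) + c k j" for j
    by (cases "Suc j \<le> k") (auto simp: c_def algebra_simps binomial_eq_0 Suc_diff_Suc[symmetric])
  have IH: "fock_power F k m ys = (\<Sum>j\<le>n. c k j * fock_power ?G j m ys)" if "m \<le> n" for m ys
  proof -
    have "fock_power F k m ys = (\<Sum>j\<le>m. c k j * fock_power ?G j m ys)"
      unfolding c_def by (rule Suc.IH)
    also have "\<dots> = (\<Sum>j\<le>n. c k j * fock_power ?G j m ys)"
      using that by (intro sum.mono_neutral_left) (auto simp: fock_power_without_constant_eq_0)
    finally show ?thesis .
  qed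
  have tm: "tensor_mult i (n - i) (?G i) (fock_power F k (n - i)) xs =
      (\<Sum>j\<le>n. c k j * tensor_mult i (n - i) (?G i) (fock_power ?G j (n - i)) xs)" for i
    by (simp add: tensor_mult_def IH sum_distrib_left mult_ac)
  have "fock_power F (Suc k) n xs =
      F 0 [] * fock_power F k n xs + fock_mult ?G (fock_power F k) n xs"
    using fock_mult_split_constant[of "fock_power F k" n, OF fock_power_in_tensor_power[OF F], of F xs]
    by simp
  also have "fock_mult ?G (fock_power F k) n xs = (\<Sum>j\<le>n. c k j * fock_power ?G (Suc j) n xs)"
    unfolding fock_mult_def tm by (subst sum.swap) (simp add: fock_mult_def sum_distrib_left)
  also have "fock_power F k n xs = (\<Sum>j\<le>Suc n. c k j * fock_power ?G j n xs)"
    using IH[of n xs] by (simp only: sum.atMost_Suc) (simp add: fock_power_without_constant_eq_0 del: fock_power.simps)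
  also have "F 0 [] * (\<Sum>j\<le>Suc n. c k j * fock_power ?G j n xs) + (\<Sum>j\<le>n. c k j * fock_power ?G (Suc j) n xs) =
      (\<Sum>j\<le>Suc n. c (Suc k) j * fock_power ?G j n xs)"
    unfolding sum.atMost_Suc_shift rec
    by (simp add: c_def algebra_simps sum.distrib sum_distrib_left del: fock_power.simps(2))
  also have "\<dots> = (\<Sum>j\<le>n. c (Suc k) j * fock_power ?G j n xs)"
    by (simp add: fock_power_without_constant_eq_0 del: fock_power.simps)
  finally show ?case by (simp only: c_def)
qed

text \<open>
  Since \<open>q_norm\<close> controls only \<open>P\<^sub>q f\<close>, a separate argument has to show that the limit is itself a
  tensor. In a fixed degree the series is a combination of the finitely many tensors of
  \<open>fock_power_binomial\<close>, with scalar series as coefficients. The scalar series converge because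
  \<open>(k choose j) \<bar>F\<^sub>0\<bar>\<^bsup>k - j\<^esup> h\<^sup>j\<close> is one term of the expansion of \<open>(\<bar>F\<^sub>0\<bar> + h)\<^sup>k = s\<^sup>k\<close>.
\<close>

lemma power_series_in_tensor_power:
  fixes F :: "nat \<Rightarrow> 'k::real_inner tensor"
  assumes F: "\<And>n. F n \<in> tensor_power n" and s: "\<bar>F 0 []\<bar> < s"
    and b: "summable (\<lambda>k. \<bar>b k\<bar> * s ^ k)"
  shows "summable (\<lambda>k. b k * fock_power F k n xs)"
    and "(\<lambda>xs. \<Sum>k. b k * fock_power F k n xs) \<in> tensor_power n"
proof -
  let ?G = "without_constant F"
  define c where "c k j = of_nat (k choose j) * F 0 [] ^ (k - j)" for k j
  define h where "h = s - \<bar>F 0 []\<bar>"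
  have h: "h > 0" using s by (simp add: h_def)
  have c: "\<bar>c k j\<bar> \<le> s ^ k / h ^ j" for k j
  proof (cases "j \<le> k")
    case True
    have "of_nat (k choose j) * h ^ j * \<bar>F 0 []\<bar> ^ (k - j) \<le>
        (\<Sum>j\<le>k. of_nat (k choose j) * h ^ j * \<bar>F 0 []\<bar> ^ (k - j))"
      using h True by (intro member_le_sum) auto
    also have "\<dots> = s ^ k" by (simp add: binomial_ring[symmetric] h_def)
    finally show ?thesis using h by (simp add: c_def abs_mult power_abs field_simps)
  next
    case False
    then show ?thesis using s h by (simp add: c_def binomial_eq_0)
  qed
  have sm: "summable (\<lambda>k. b k * c k j)" for j
  proof (rule summable_comparison_test')
    show "summable (\<lambda>k. \<bar>b k\<bar> * s ^ k / h ^ j)" by (rule summable_divide[OF b])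
    show "norm (b k * c k j) \<le> \<bar>b k\<bar> * s ^ k / h ^ j" if "k \<ge> 0" for k
      using mult_left_mono[OF c[of k j], of "\<bar>b k\<bar>"] by (simp add: abs_mult)
  qed
  have sums: "(\<lambda>k. b k * fock_power F k n xs) sums
      (\<Sum>j\<le>n. (\<Sum>k. b k * c k j) * fock_power ?G j n xs)" for xs
  proof -
    have "(\<lambda>k. \<Sum>j\<le>n. (b k * c k j) * fock_power ?G j n xs) sums
        (\<Sum>j\<le>n. (\<Sum>k. b k * c k j) * fock_power ?G j n xs)"
      by (intro sums_sum sums_mult2 summable_sums sm)
    then show ?thesis
      by (simp add: fock_power_binomial[OF F] c_def sum_distrib_left mult.assoc)
  qed
  from sums show "summable (\<lambda>k. b k * fock_power F k n xs)" by (rule sums_summable)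
  have "?G m \<in> tensor_power m" for m
    by (cases "m = 0") (simp_all add: without_constant_def F tensor_power_zero)
  then have "(\<lambda>xs. \<Sum>j\<le>n. (\<Sum>k. b k * c k j) * fock_power ?G j n xs) \<in> tensor_power n"
    by (intro tensor_power_linear_combination fock_power_in_tensor_power) auto
  then show "(\<lambda>xs. \<Sum>k. b k * fock_power F k n xs) \<in> tensor_power n"
    by (simp add: sums_unique[OF sums, symmetric])
qed

section \<open>Power series in the Fock space\<close>

lemma fock_weight_q_inner:
  "fock_weight q (w\<^sup>2) (-2) n * q_inner q n f f = (w ^ n * q_norm q n f)\<^sup>2"
  using q_factorial_pos[of q n] q_inner_nonneg[of q n f]
  by (simp add: fock_weight_def q_norm_def powr_minus powr_numeral power_mult_distrib power_divide
      power_mult[symmetric] power_inverse mult.commute divide_inverse)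

text \<open>
  The \<open>\<ell>\<^sup>2\<close> norm of the graded norms is at most their \<open>\<ell>\<^sup>1\<close> norm.
\<close>

lemma fock_partial_norm_bound:
  assumes H: "\<And>n. H n \<in> tensor_power n" and w: "w \<ge> 0"
    and le: "\<And>M. fock_partial_norm q w M H \<le> t"
  shows "H \<in> fock q (w\<^sup>2) (-2)" "fock_inner q (w\<^sup>2) (-2) H H \<le> t\<^sup>2"
proof -
  let ?u = "\<lambda>n. (w ^ n * q_norm q n (H n))\<^sup>2"
  have part: "(\<Sum>n<M. ?u n) \<le> t\<^sup>2" for M
  proof -
    have "(\<Sum>n<M. ?u n) = (L2_set (\<lambda>n. w ^ n * q_norm q n (H n)) {..<M})\<^sup>2"
      by (simp add: L2_set_def sum_nonneg)
    also have "\<dots> \<le> (\<Sum>n<M. w ^ n * q_norm q n (H n))\<^sup>2"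
      using w by (intro power_mono L2_set_le_sum) (auto simp: q_norm_nonneg)
    also have "\<dots> \<le> (fock_partial_norm q w M H)\<^sup>2"
      unfolding fock_partial_norm_def using w
      by (intro power_mono sum_mono2) (auto simp: q_norm_nonneg intro!: sum_nonneg)
    also have "\<dots> \<le> t\<^sup>2"
      using w by (intro power_mono le fock_partial_norm_nonneg)
    finally show ?thesis .
  qed
  have sm: "summable ?u"
    by (rule summableI_nonneg_bounded[where x = "t\<^sup>2"]) (use part in auto)
  then show "H \<in> fock q (w\<^sup>2) (-2)"
    using H by (simp add: fock_def fock_weight_q_inner)
  show "fock_inner q (w\<^sup>2) (-2) H H \<le> t\<^sup>2"
    unfolding fock_inner_def fock_weight_q_inner by (rule suminf_le_const[OF sm part])
qed

lemma fock_inner_nonneg: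
  assumes "F \<in> fock q (w\<^sup>2) (-2)"
  shows "0 \<le> fock_inner q (w\<^sup>2) (-2) F F"
  using assms unfolding fock_inner_def fock_def by (auto simp: fock_weight_q_inner intro!: suminf_nonneg)

text \<open>
  The \<open>k\<close>-th power of \<open>F\<close> has weighted \<open>\<ell>\<^sup>1\<close> norm at most \<open>s\<^sup>k\<close>, so the scalar series
  \<open>\<Sum>\<^sub>k \<bar>b\<^sub>k\<bar> s\<^sup>k\<close> majorises the tensor series. The same estimate serves for the sum of the series, for
  its partial sums and for its tails, by changing the coefficients \<open>b\<close>.
\<close>

lemma power_series_in_fock:
  fixes F H :: "nat \<Rightarrow> 'k::real_inner tensor"
  assumes F: "\<And>n. F n \<in> tensor_power n" and f0: "\<bar>F 0 []\<bar> < s"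
    and w: "w > 0" and le: "\<And>M. fock_partial_norm q w M F \<le> s"
    and b: "summable (\<lambda>k. \<bar>b k\<bar> * s ^ k)"
    and H: "\<And>n xs. (\<lambda>k. b k * fock_power F k n xs) sums H n xs"
  shows "H \<in> fock q (w\<^sup>2) (-2)"
    and "fock_inner q (w\<^sup>2) (-2) H H \<le> (\<Sum>k. \<bar>b k\<bar> * s ^ k)\<^sup>2"
proof -
  have H_eq: "H n = (\<lambda>xs. \<Sum>k. b k * fock_power F k n xs)" for n
    using H by (simp add: sums_iff)
  have Hn: "H n \<in> tensor_power n" for n
    unfolding H_eq by (rule power_series_in_tensor_power(2)[OF F f0 b])
  have pw: "fock_partial_norm q w M (fock_power F k) \<le> s ^ k" for M k
    using w by (intro fock_partial_norm_power_le F le) simp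
  have sm: "summable (\<lambda>k. \<bar>b k\<bar> * (w ^ n * q_norm q n (fock_power F k n)))" for n
  proof (rule summable_comparison_test'[OF b])
    fix k
    have "w ^ n * q_norm q n (fock_power F k n) \<le> fock_partial_norm q w n (fock_power F k)"
      unfolding fock_partial_norm_def using w by (intro member_le_sum) (auto simp: q_norm_nonneg)
    also have "\<dots> \<le> s ^ k" by (rule pw)
    finally show "norm (\<bar>b k\<bar> * (w ^ n * q_norm q n (fock_power F k n))) \<le> \<bar>b k\<bar> * s ^ k"
      using w by (simp add: abs_mult q_norm_nonneg mult_left_mono)
  qed
  have "fock_partial_norm q w M H \<le> (\<Sum>k. \<bar>b k\<bar> * s ^ k)" for M
  proof -
    have "w ^ n * q_norm q n (H n) \<le> (\<Sum>k. \<bar>b k\<bar> * (w ^ n * q_norm q n (fock_power F k n)))" for n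
    proof -
      have s1: "summable (\<lambda>k. \<bar>b k\<bar> * q_norm q n (fock_power F k n))"
        using summable_mult[OF sm[of n], of "inverse (w ^ n)"] w by (simp add: field_simps)
      have "w ^ n * q_norm q n (H n) \<le> w ^ n * (\<Sum>k. \<bar>b k\<bar> * q_norm q n (fock_power F k n))"
        using w by (intro mult_left_mono q_norm_sums_le s1 H fock_power_in_tensor_power F) auto
      also have "\<dots> = (\<Sum>k. \<bar>b k\<bar> * (w ^ n * q_norm q n (fock_power F k n)))"
        by (subst suminf_mult[OF s1, symmetric]) (simp add: mult_ac)
      finally show ?thesis .
    qed
    then have "fock_partial_norm q w M H \<le>
        (\<Sum>n\<le>M. \<Sum>k. \<bar>b k\<bar> * (w ^ n * q_norm q n (fock_power F k n)))"
      unfolding fock_partial_norm_def by (rule sum_mono)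
    also have "\<dots> = (\<Sum>k. \<bar>b k\<bar> * fock_partial_norm q w M (fock_power F k))"
      by (subst suminf_sum[symmetric]) (simp_all add: sm fock_partial_norm_def sum_distrib_left)
    also have "\<dots> \<le> (\<Sum>k. \<bar>b k\<bar> * s ^ k)"
    proof (rule suminf_le[OF _ _ b])
      show "\<bar>b k\<bar> * fock_partial_norm q w M (fock_power F k) \<le> \<bar>b k\<bar> * s ^ k" for k
        by (intro mult_left_mono pw) simp
      show "summable (\<lambda>k. \<bar>b k\<bar> * fock_partial_norm q w M (fock_power F k))"
        unfolding fock_partial_norm_def sum_distrib_left by (intro summable_sum sm)
    qed
    finally show ?thesis .
  qed
  then show "H \<in> fock q (w\<^sup>2) (-2)" "fock_inner q (w\<^sup>2) (-2) H H \<le> (\<Sum>k. \<bar>b k\<bar> * s ^ k)\<^sup>2"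
    using fock_partial_norm_bound[OF Hn less_imp_le[OF w], where t = "\<Sum>k. \<bar>b k\<bar> * s ^ k"] by blast+
qed

text \<open>
  Lowering the weight \<open>w\<close> shrinks the components of positive degree and leaves the component of
  degree zero alone. Membership in one Fock space gives \<open>q_norm q n (F n) \<le> C / v\<^sup>n\<close>, so a geometric
  series bounds the positive degrees by the gap between \<open>s\<close> and \<open>\<bar>F\<^sub>0\<bar>\<close>.
\<close>

lemma small_fock_partial_norm:
  fixes F :: "nat \<Rightarrow> 'k::real_inner tensor"
  assumes "F \<in> fock q (inverse r) (-2)" "r \<ge> 1" "\<bar>F 0 []\<bar> < s"
  obtains w where "0 < w" "w \<le> 1" "\<And>M. fock_partial_norm q w M F \<le> s"
proof -
  define v h where "v = inverse (sqrt r)" and "h = s - \<bar>F 0 []\<bar>"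
  have v: "0 < v" "v \<le> 1" "v\<^sup>2 = inverse r" and h: "h > 0"
    using assms(2,3) by (simp_all add: v_def h_def power_inverse inverse_le_1_iff)
  have "summable (\<lambda>n. (v ^ n * q_norm q n (F n))\<^sup>2)"
    using assms(1) unfolding fock_weight_q_inner[symmetric] v(3) by (simp add: fock_def)
  then obtain K where K: "K > 0" "\<And>n. norm ((v ^ n * q_norm q n (F n))\<^sup>2) \<le> K"
    by (rule BseqE[OF summable_imp_Bseq]) simp
  define C where "C = sqrt K"
  have C: "C > 0" "v ^ n * q_norm q n (F n) \<le> C" for n
    using K v by (auto simp: C_def intro!: real_le_rsqrt)
  \<comment> \<open>The ratio for which the geometric series \<open>C (x + x\<^sup>2 + \<dots>)\<close> equals \<open>h\<close>.\<close>
  define x where "x = h / (h + C)"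
  have x: "0 < x" "x < 1" using h C(1) by (simp_all add: x_def)
  have "1 - x = C / (h + C)" using h C(1) by (simp add: x_def field_simps)
  then have xh: "C * x / (1 - x) = h" using h C(1) by (simp add: x_def)
  have "fock_partial_norm q (v * x) M F \<le> s" for M
  proof -
    have "fock_partial_norm q (v * x) M F =
        \<bar>F 0 []\<bar> + (\<Sum>n<M. x ^ Suc n * (v ^ Suc n * q_norm q (Suc n) (F (Suc n))))"
      by (simp add: fock_partial_norm_def sum.atMost_shift q_norm_0 power_mult_distrib mult_ac)
    also have "\<dots> \<le> \<bar>F 0 []\<bar> + (\<Sum>n<M. x ^ Suc n * C)"
      using x by (intro add_left_mono sum_mono mult_left_mono C) auto
    also have "(\<Sum>n<M. x ^ Suc n * C) = C * x * (\<Sum>n<M. x ^ n)"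
      by (simp add: sum_distrib_left mult_ac)
    also have "\<dots> \<le> C * x * (\<Sum>n. x ^ n)"
      using x C(1) by (intro mult_left_mono sum_le_suminf) auto
    also have "\<dots> = h" using x xh by (simp add: suminf_geometric)
    finally show ?thesis by (simp add: h_def)
  qed
  moreover have "0 < v * x" "v * x \<le> 1" using v x by (simp_all add: mult_le_one)
  ultimately show thesis using that by blast
qed

text \<open>
  The real and imaginary parts of the coefficients are treated separately; \<open>t\<close> stands for the common
  majorant \<open>\<bar>a\<^sub>k\<bar> s\<^sup>k\<close>, so that both parts have the same bound on the tail.
\<close>

lemma real_power_series_converges:
  fixes F :: "nat \<Rightarrow> 'k::real_inner tensor"
  assumes F: "\<And>n. F n \<in> tensor_power n" and s: "\<bar>F 0 []\<bar> < s"
    and w: "w > 0" and Fs: "\<And>M. fock_partial_norm q w M F \<le> s"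
    and t: "summable t" and b: "\<And>k. \<bar>b k\<bar> * s ^ k \<le> t k"
  defines "H \<equiv> \<lambda>n xs. \<Sum>k. b k * fock_power F k n xs"
    and "S \<equiv> \<lambda>N n xs. \<Sum>k<N. b k * fock_power F k n xs"
  shows "H \<in> fock q (w\<^sup>2) (-2)" and "S N \<in> fock q (w\<^sup>2) (-2)"
    and "0 \<le> fock_inner q (w\<^sup>2) (-2) (\<lambda>n xs. S N n xs - H n xs) (\<lambda>n xs. S N n xs - H n xs)"
    and "fock_inner q (w\<^sup>2) (-2) (\<lambda>n xs. S N n xs - H n xs) (\<lambda>n xs. S N n xs - H n xs)
      \<le> (suminf t - (\<Sum>k<N. t k))\<^sup>2"
proof -
  have s0: "0 \<le> s" using s by linarith
  have series: "K \<in> fock q (w\<^sup>2) (-2) \<and> fock_inner q (w\<^sup>2) (-2) K K \<le> (\<Sum>k. d k)\<^sup>2"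
    if d: "summable d" and c: "\<And>k. \<bar>c k\<bar> * s ^ k \<le> d k"
      and K: "\<And>n xs. (\<lambda>k. c k * fock_power F k n xs) sums K n xs" for c d K
  proof -
    have sc: "summable (\<lambda>k. \<bar>c k\<bar> * s ^ k)"
    proof (rule summable_comparison_test'[OF d])
      show "norm (\<bar>c k\<bar> * s ^ k) \<le> d k" for k using c[of k] s0 by simp
    qed
    have "(\<Sum>k. \<bar>c k\<bar> * s ^ k)\<^sup>2 \<le> (\<Sum>k. d k)\<^sup>2"
      using s0 by (intro power_mono suminf_le c sc d suminf_nonneg) auto
    then show ?thesis
      using power_series_in_fock[OF F s w Fs sc K] by (blast intro: order.trans)
  qed
  have sb: "summable (\<lambda>k. \<bar>b k\<bar> * s ^ k)"
  proof (rule summable_comparison_test'[OF t])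
    show "norm (\<bar>b k\<bar> * s ^ k) \<le> t k" for k using b[of k] s0 by simp
  qed
  have H: "(\<lambda>k. b k * fock_power F k n xs) sums H n xs" for n xs
    unfolding H_def by (rule summable_sums[OF power_series_in_tensor_power(1)[OF F s sb]])
  show "H \<in> fock q (w\<^sup>2) (-2)" using series[OF t b H] by blast
  have t0: "0 \<le> t k" for k
  proof -
    have "0 \<le> \<bar>b k\<bar> * s ^ k" using s0 by simp
    then show ?thesis using b[of k] by linarith
  qed
  have S: "(\<lambda>k. (if k < N then b k else 0) * fock_power F k n xs) sums S N n xs" for n xs
    unfolding S_def
    using sums_If_finite[of "\<lambda>k. k < N" "\<lambda>k. b k * fock_power F k n xs"]
    by (simp add: lessThan_def if_distrib[of "\<lambda>c. c * _"] cong: if_cong)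
  have "\<bar>if k < N then b k else 0\<bar> * s ^ k \<le> t k" for k
    using b[of k] t0[of k] by simp
  from series[OF t this S] show "S N \<in> fock q (w\<^sup>2) (-2)" by blast
  have tail: "(\<lambda>k. if k < N then 0 else t k) sums (suminf t - (\<Sum>k<N. t k))"
  proof -
    have "(\<lambda>k. t k - (if k < N then t k else 0)) sums (suminf t - (\<Sum>k | k < N. t k))"
      by (intro sums_diff summable_sums t sums_If_finite) simp
    moreover have "(\<lambda>k. t k - (if k < N then t k else 0)) = (\<lambda>k. if k < N then 0 else t k)" by auto
    ultimately show ?thesis by (simp add: lessThan_def)
  qed
  have diff: "(\<lambda>k. (if k < N then 0 else - b k) * fock_power F k n xs) sums (S N n xs - H n xs)" for n xs
  proof -
    have "(\<lambda>k. (if k < N then b k else 0) * fock_power F k n xs - b k * fock_power F k n xs) =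
        (\<lambda>k. (if k < N then 0 else - b k) * fock_power F k n xs)" by auto
    then show ?thesis using sums_diff[OF S H, of n xs n xs] by simp
  qed
  have le: "\<bar>if k < N then 0 else - b k\<bar> * s ^ k \<le> (if k < N then 0 else t k)" for k
    using b[of k] by simp
  note D = series[OF sums_summable[OF tail] le diff]
  show "fock_inner q (w\<^sup>2) (-2) (\<lambda>n xs. S N n xs - H n xs) (\<lambda>n xs. S N n xs - H n xs)
      \<le> (suminf t - (\<Sum>k<N. t k))\<^sup>2"
    using D sums_unique[OF tail] by simp
  show "0 \<le> fock_inner q (w\<^sup>2) (-2) (\<lambda>n xs. S N n xs - H n xs) (\<lambda>n xs. S N n xs - H n xs)"
    using D by (blast intro: fock_inner_nonneg)
qed

theorem theorem5p7:
  fixes q R :: real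
    and J :: "'p::{real_inner, complete_space} \<Rightarrow> 'h::{real_inner, complete_space}"
    and I :: "'h \<Rightarrow> 'm::{real_inner, complete_space}"
    and D :: "'m \<Rightarrow> 'p \<Rightarrow>\<^sub>L real"
    and \<phi> :: "complex \<Rightarrow> complex"
    and a :: "nat \<Rightarrow> complex"
    and F :: "nat \<Rightarrow> 'm tensor"
  assumes "-1 < q" and "q < 1"
    and "separable_space (euclidean :: 'h topology)"
    and "dense_embedding J" and "\<And>x. norm (J x) \<le> norm x"
    and "dual_wrt_center J I D"
    and "\<phi> analytic_on {0}"
    and "eventually (\<lambda>z. (\<lambda>n. a n * z ^ n) sums \<phi> z) (nhds 0)"
    and "R > 0"
    and "\<And>z. norm z < R \<Longrightarrow> summable (\<lambda>n. norm (a n * z ^ n))"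
    and "F \<in> fock_ind_lim q (-2)"
    and "\<bar>F 0 []\<bar> < R"
  shows "\<exists>\<Phi>. \<Phi> \<in> complexification (fock_ind_lim q (-2)) \<and>
    (\<exists>r\<ge>1. converges_in_cfock q (inverse r) (-2) (tensor_series_partial a F) \<Phi>)"
proof -
  \<comment> \<open>A radius with room on both sides: above \<open>\<bar>F\<^sub>0\<bar>\<close> for the positive degrees of \<open>F\<close>, below \<open>R\<close> for the series.\<close>
  define s where "s = (\<bar>F 0 []\<bar> + R) / 2"
  have s: "\<bar>F 0 []\<bar> < s" "s < R" "0 \<le> s"
    using assms(12) abs_ge_zero[of "F 0 []"] by (simp_all add: s_def)
  obtain r0 where r0: "r0 \<ge> 1" "F \<in> fock q (inverse r0) (-2)"
    using assms(11) by (auto simp: fock_ind_lim_def)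
  then have F: "F n \<in> tensor_power n" for n by (simp add: fock_def)
  obtain w where w: "0 < w" "w \<le> 1" and Fs: "\<And>M. fock_partial_norm q w M F \<le> s"
    using small_fock_partial_norm[OF r0(2,1) s(1)] by blast
  \<comment> \<open>The weights multiply squared norms, hence the square.\<close>
  define r where "r = inverse (w\<^sup>2)"
  have r: "r \<ge> 1" "inverse r = w\<^sup>2"
    using w by (simp_all add: r_def one_le_inverse_iff power_le_one)
  define t where "t k = norm (a k) * s ^ k" for k
  have t: "summable t" and t0: "t k \<ge> 0" for k
    using assms(10)[of "of_real s"] s by (simp_all add: t_def[abs_def] norm_mult norm_power)
  define T where "T N = suminf t - (\<Sum>k<N. t k)" for N
  have T_lim: "T \<longlonglongrightarrow> 0"
    using tendsto_diff[OF tendsto_const[of "suminf t"] summable_LIMSEQ[OF t]]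
    by (simp add: T_def[abs_def])
  have Re_le: "\<bar>Re (a k)\<bar> * s ^ k \<le> t k" and Im_le: "\<bar>Im (a k)\<bar> * s ^ k \<le> t k" for k
    using s(3) by (auto simp: t_def abs_Re_le_cmod abs_Im_le_cmod intro!: mult_right_mono)
  note Re_part = real_power_series_converges[OF F s(1) w(1) Fs t, of "\<lambda>k. Re (a k)", OF Re_le]
  note Im_part = real_power_series_converges[OF F s(1) w(1) Fs t, of "\<lambda>k. Im (a k)", OF Im_le]
  define \<Phi> where "\<Phi> n xs = Complex (\<Sum>k. Re (a k) * fock_power F k n xs)
    (\<Sum>k. Im (a k) * fock_power F k n xs)" for n xs
  have Phi: "\<Phi> \<in> complexification (fock q (w\<^sup>2) (-2))"
    using Re_part(1) Im_part(1) by (simp add: complexification_def Re_seq_def Im_seq_def \<Phi>_def)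
  have "converges_in_cfock q (w\<^sup>2) (-2) (tensor_series_partial a F) \<Phi>"
    unfolding converges_in_cfock_def
  proof (intro conjI allI Phi)
    show "tensor_series_partial a F N \<in> complexification (fock q (w\<^sup>2) (-2))" for N
      using Re_part(2) Im_part(2)
      by (simp add: complexification_def Re_seq_def Im_seq_def tensor_series_partial_def)
    let ?d = "\<lambda>N. cfock_norm q (w\<^sup>2) (-2) (\<lambda>n xs. tensor_series_partial a F N n xs - \<Phi> n xs)"
    have parts: "Re_seq (\<lambda>n xs. tensor_series_partial a F N n xs - \<Phi> n xs) = (\<lambda>n xs.
          (\<Sum>k<N. Re (a k) * fock_power F k n xs) - (\<Sum>k. Re (a k) * fock_power F k n xs))"
        "Im_seq (\<lambda>n xs. tensor_series_partial a F N n xs - \<Phi> n xs) = (\<lambda>n xs.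
          (\<Sum>k<N. Im (a k) * fock_power F k n xs) - (\<Sum>k. Im (a k) * fock_power F k n xs))" for N
      by (simp_all add: Re_seq_def Im_seq_def tensor_series_partial_def \<Phi>_def)
    have "0 \<le> ?d N" for N
      unfolding cfock_norm_def parts real_sqrt_ge_0_iff
      by (rule add_nonneg_nonneg[OF Re_part(3) Im_part(3)])
    moreover have "?d N \<le> sqrt ((T N)\<^sup>2 + (T N)\<^sup>2)" for N
      unfolding cfock_norm_def parts T_def real_sqrt_le_iff
      by (rule add_mono[OF Re_part(4) Im_part(4)])
    moreover have "(\<lambda>N. sqrt ((T N)\<^sup>2 + (T N)\<^sup>2)) \<longlonglongrightarrow> sqrt (0\<^sup>2 + 0\<^sup>2)"
      by (intro tendsto_intros T_lim)
    then have "(\<lambda>N. sqrt ((T N)\<^sup>2 + (T N)\<^sup>2)) \<longlonglongrightarrow> 0" by simp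
    ultimately show "?d \<longlonglongrightarrow> 0"
      by (intro tendsto_sandwich[where f = "\<lambda>_. 0" and g = ?d and h = "\<lambda>N. sqrt ((T N)\<^sup>2 + (T N)\<^sup>2)"])
        simp_all
  qed
  moreover have "\<Phi> \<in> complexification (fock_ind_lim q (-2))"
    using Phi r unfolding complexification_def fock_ind_lim_def by (auto intro!: bexI[of _ r])
  ultimately show ?thesis using r by (intro exI[of _ \<Phi>] conjI exI[of _ r]) simp_all
qed

end
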